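(* Let $n\ge8$ be a multiple of $4$. Then $\Theta_{W_n}=\tfrac12(\theta_2^n+\theta_3^n+\theta_4^n)$; $\Theta_{W_n,P}=0$ for all $P\in\mathrm{Harm}_2(\mathbb R^n)$; there exist nonzero linear forms $c_1$ on $\mathrm{Harm}_4(\mathbb R^n)$ and $c_2$ on $\mathrm{Harm}_6(\mathbb R^n)$ such that $$\Theta_{W_n,P}=c_1(P)\,\theta_2^4\theta_3^4\theta_4^4\bigl(-\theta_2^{n-4}+\theta_3^{n-4}-\theta_4^{n-4}\bigr)\quad(P\in\mathrm{Harm}_4(\mathbb R^n)),$$ $$\Theta_{W_n,P}=c_2(P)\,\theta_2^4\theta_3^4\theta_4^4\bigl((\theta_3^4+\theta_4^4)\theta_2^{n-4}+(\theta_4^4-\theta_2^4)\theta_3^{n-4}-(\theta_2^4+\theta_3^4)\theta_4^{n-4}\bigr)\quad(P\in\mathrm{Harm}_6(\mathbb R^n)).$$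
   Context: For $n$ a positive multiple of $4$, the Witt lattice is $W_n=\{x\in\mathbb R^n: 2x_i\in\mathbb Z\ \forall i,\ x_i-x_1\in\mathbb Z\ \forall i,\ x_1+\cdots+x_n\in2\mathbb Z\}$. $\mathrm{Harm}_j(\mathbb R^n)$ is the space of homogeneous harmonic polynomials of degree $j$. With $q=e^{i\pi z}$: $\theta_2=\sum_{m\in\mathbb Z+1/2}q^{m^2}$, $\theta_3=\sum_{m\in\mathbb Z}q^{m^2}$, $\theta_4=\sum_{m\in\mathbb Z}(-q)^{m^2}$. For a polynomial $P$, $\Theta_{\Lambda,P}(z)=\sum_{x\in\Lambda}P(x)q^{\langle x,x\rangle}$, $\Theta_\Lambda=\Theta_{\Lambda,1}$. *)

theory Defs
  imports "HOL-Analysis.Analysis"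
begin

text \<open>Vectors of R^n are represented as functions nat => real vanishing at
  indices >= n (coordinates x 0, ..., x (n-1)).\<close>

definition witt_lattice :: "nat \<Rightarrow> (nat \<Rightarrow> real) set" where
  "witt_lattice n = {x. (\<forall>i\<ge>n. x i = 0) \<and> (\<forall>i<n. 2 * x i \<in> \<int>)
      \<and> (\<forall>i<n. x i - x 0 \<in> \<int>) \<and> (\<exists>k::int. (\<Sum>i<n. x i) = 2 * of_int k)}"

definition sqnorm :: "nat \<Rightarrow> (nat \<Rightarrow> real) \<Rightarrow> real" where
  "sqnorm n x = (\<Sum>i<n. (x i)\<^sup>2)"

text \<open>Polynomials in n variables with real coefficients, given by their
  coefficient function on exponent vectors (nat => nat, zero at indices >= n).\<close>

type_synonym rpoly = "(nat \<Rightarrow> nat) \<Rightarrow> real"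

definition is_rpoly :: "nat \<Rightarrow> rpoly \<Rightarrow> bool" where
  "is_rpoly n c \<longleftrightarrow> finite {\<alpha>. c \<alpha> \<noteq> 0} \<and> (\<forall>\<alpha>. c \<alpha> \<noteq> 0 \<longrightarrow> (\<forall>i\<ge>n. \<alpha> i = 0))"

definition homogeneous :: "nat \<Rightarrow> nat \<Rightarrow> rpoly \<Rightarrow> bool" where
  "homogeneous n j c \<longleftrightarrow> (\<forall>\<alpha>. c \<alpha> \<noteq> 0 \<longrightarrow> (\<Sum>i<n. \<alpha> i) = j)"

definition poly_eval :: "nat \<Rightarrow> rpoly \<Rightarrow> (nat \<Rightarrow> real) \<Rightarrow> real" where
  "poly_eval n c x = (\<Sum>\<alpha>\<in>{\<alpha>. c \<alpha> \<noteq> 0}. c \<alpha> * (\<Prod>i<n. x i ^ \<alpha> i))"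

text \<open>Laplacian on coefficients: coefficient of x^beta in sum_i d^2 P / dx_i^2.\<close>
definition laplacian :: "nat \<Rightarrow> rpoly \<Rightarrow> rpoly" where
  "laplacian n c = (\<lambda>\<beta>. \<Sum>i<n. real ((\<beta> i + 2) * (\<beta> i + 1)) * c (\<beta>(i := \<beta> i + 2)))"

definition Harm :: "nat \<Rightarrow> nat \<Rightarrow> rpoly set" where
  "Harm n j = {c. is_rpoly n c \<and> homogeneous n j c \<and> laplacian n c = (\<lambda>_. 0)}"

definition linear_form_on :: "rpoly set \<Rightarrow> (rpoly \<Rightarrow> real) \<Rightarrow> bool" where
  "linear_form_on S L \<longleftrightarrow> (\<forall>P\<in>S. \<forall>Q\<in>S. \<forall>a b::real.
      L (\<lambda>\<alpha>. a * P \<alpha> + b * Q \<alpha>) = a * L P + b * L Q)"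

definition lattice_theta :: "nat \<Rightarrow> (nat \<Rightarrow> real) set \<Rightarrow> ((nat \<Rightarrow> real) \<Rightarrow> real) \<Rightarrow> complex \<Rightarrow> complex" where
  "lattice_theta n L P z = (\<Sum>\<^sub>\<infinity>x\<in>L. complex_of_real (P x) * exp (\<i> * pi * z * complex_of_real (sqnorm n x)))"

definition theta2 :: "complex \<Rightarrow> complex" where
  "theta2 z = (\<Sum>\<^sub>\<infinity>m\<in>(UNIV::int set). exp (\<i> * pi * z * (of_int m + 1/2)\<^sup>2))"

definition theta3 :: "complex \<Rightarrow> complex" where
  "theta3 z = (\<Sum>\<^sub>\<infinity>m\<in>(UNIV::int set). exp (\<i> * pi * z) ^ nat (m\<^sup>2))"

definition theta4 :: "complex \<Rightarrow> complex" where
  "theta4 z = (\<Sum>\<^sub>\<infinity>m\<in>(UNIV::int set). (- exp (\<i> * pi * z)) ^ nat (m\<^sup>2))"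

end

theory Submission
  imports Defs
begin

text \<open>
  Since $W_n$ is the union of $D_n$ and its translate by $(1/2,\ldots,1/2)$, the theta series of a monomial
  is half the sum of four products of one-dimensional moments $\sum_m \pm m^a q^{m^2}$ over the integers or
  half-integers; the last product vanishes for degree less than $n$. For even $a$ the other moments are the
  derivatives of $\theta_2, \theta_3, \theta_4$ under $D = q\,d/dq$, and for odd $a$ they vanish. Harmonicity
  ties the coefficients together, so that with $u_k = D \log \theta_k$ and $S$ the sum of the coefficients of the
  pure powers $x_i^j$ one gets $0$ for $j = 2$, $\frac{S}{2} \sum_k \theta_k^n (Du_k - 2u_k^2)$ for $j = 4$ and
  $\frac{S}{2} \sum_k \theta_k^n (D^2u_k - 12 u_k Du_k + 16 u_k^3)$ for $j = 6$.

  It remains to know $u_2 - u_3 = \theta_4^4/4$, $u_3 - u_4 = \theta_2^4/4$ and the Halphen system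
  $Du_2 = 2 (u_2 u_3 + u_2 u_4 - u_3 u_4)$ together with its permutations. No modularity is needed: Landen's
  transformation relates the values at $z$ and $2z$, which makes the quotient $(u_2 - u_3)/\theta_4^4$ and
  $(\mathrm{Im}\,z)^2$ times the defect of the Halphen system invariant under $z \mapsto 2z$; both are therefore
  equal to their limits $1/4$ and $0$ at $i\infty$. Nonvanishing of the $\theta_k$ follows in the same way.
\<close>

subsection \<open>Moments of one-dimensional theta series\<close>

text \<open>The constants are cumulants. Let V be a sequence with V 0 = 1 and vanishing odd entries,
  with cumulants kappa_j. The functional sending a monomial to the product of the V at its exponents
  has as exponential generating function the exponential of the sum over i of kappa_2 x_i^2 / 2! +
  kappa_4 x_i^4 / 4! + kappa_6 x_i^6 / 6! + ... The quadratic part depends only on the sum of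
  squares, and multiples of that sum pair to zero with harmonic polynomials. So in degrees 4 and 6
  only kappa_4 or kappa_6 times the sum of pure powers survives. This is the origin of S and of V 4
  - 3 (V 2)^2 and V 6 - 15 V 2 V 4 + 30 (V 2)^3; in degree 8 the square of the quartic part would
  enter as well. For theta series these cumulants involve derivatives of u_k, and the Halphen system
  is what removes the derivatives and leaves products of differences of the u_k.\<close>

definition twist :: "bool \<Rightarrow> int \<Rightarrow> complex" where
  "twist b m = (if b \<and> odd m then -1 else 1)"

lemma norm_twist [simp]: "norm (twist b m) = 1"
  by (simp add: twist_def)

lemma twist_False [simp]: "twist False m = 1"
  by (simp add: twist_def)

lemma twist_add: "twist b (m + k) = twist b m * twist b k"
  by (simp add: twist_def)

lemma twist_uminus [simp]: "twist b (- m) = twist b m"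
  by (simp add: twist_def)

lemma twist_sum: "finite A \<Longrightarrow> twist b (\<Sum>i\<in>A. m i) = (\<Prod>i\<in>A. twist b (m i))"
  by (induction A rule: finite_induct) (simp_all add: twist_add, simp add: twist_def)

text \<open>The parameters \<open>b\<close> and \<open>s\<close> cover four cases at once. With
  \<open>a = 0\<close>, the pairs (False, 1/2), (False, 0) and (True, 0) belong to
  \<open>theta2\<close>, \<open>theta3\<close> and \<open>theta4\<close>; the pair (True, 1/2)
  belongs to the theta constant that vanishes identically.\<close>

definition theta_term :: "bool \<Rightarrow> real \<Rightarrow> nat \<Rightarrow> complex \<Rightarrow> int \<Rightarrow> complex" where
  "theta_term b s a z m = twist b m * of_real ((of_int m + s) ^ a) *
     exp (\<i> * pi * z * of_real ((of_int m + s)\<^sup>2))"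

definition theta_moment :: "bool \<Rightarrow> real \<Rightarrow> nat \<Rightarrow> complex \<Rightarrow> complex" where
  "theta_moment b s a z = (\<Sum>\<^sub>\<infinity>m. theta_term b s a z m)"

lemma norm_theta_term:
  "norm (theta_term b s a z m) = \<bar>of_int m + s\<bar> ^ a * exp (- pi * Im z * (of_int m + s)\<^sup>2)"
  by (simp add: theta_term_def norm_mult power_abs del: of_real_power of_real_add of_real_of_int_eq)

section \<open>Gaussian convergence and termwise differentiation\<close>

lemma summable_on_exp_neg_abs_int: "(\<lambda>m::int. exp (- \<bar>of_int m\<bar> :: real)) summable_on UNIV"
proof -
  have *: "(\<lambda>n::nat. exp (- real n)) summable_on UNIV"
  proof (rule summable_nonneg_imp_summable_on)
    have "summable (\<lambda>n::nat. exp (-1 :: real) ^ n)"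
      by (rule summable_geometric) simp
    thus "summable (\<lambda>n. exp (- real n))"
      by (simp add: exp_of_nat_mult [symmetric])
  qed simp
  have "(\<lambda>m::int. exp (- \<bar>of_int m\<bar> :: real)) summable_on (range int \<union> range (\<lambda>n. - int n))"
  proof (rule summable_on_union)
    show "(\<lambda>m::int. exp (- \<bar>of_int m\<bar> :: real)) summable_on range int"
      using * by (subst summable_on_reindex) (auto simp: o_def)
    show "(\<lambda>m::int. exp (- \<bar>of_int m\<bar> :: real)) summable_on range (\<lambda>n. - int n)"
      using * by (subst summable_on_reindex) (auto simp: o_def inj_on_def)
  qed
  also have "range int \<union> range (\<lambda>n. - int n) = UNIV"
  proof (intro set_eqI iffI UNIV_I)
    fix m :: int
    show "m \<in> range int \<union> range (\<lambda>n. - int n)"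
      by (cases m rule: int_cases2) auto
  qed
  finally show ?thesis .
qed

lemma summable_on_power_gauss:
  fixes c s :: real
  assumes "c > 0"
  shows "(\<lambda>m::int. \<bar>of_int m + s\<bar> ^ a * exp (- c * (of_int m + s)\<^sup>2)) summable_on UNIV"
proof (rule summable_on_comparison_test)
  \<comment> \<open>\<open>fact a\<close> comes from t^a <= a! e^t, 9/(4c) is the maximum of 3 t - c
    t^2, and \<open>exp \<bar>s\<bar>\<close> pays for passing from |m + s| to |m|.\<close>
  let ?K = "fact a * exp (9 / (4 * c)) * exp \<bar>s\<bar> :: real"
  show "(\<lambda>m::int. ?K * exp (- \<bar>of_int m\<bar> :: real)) summable_on UNIV"
    by (intro summable_on_cmult_right summable_on_exp_neg_abs_int)
  fix m :: int
  define t where "t = \<bar>of_int m + s\<bar>"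
  have t: "t \<ge> 0" "(of_int m + s)\<^sup>2 = t\<^sup>2" by (auto simp: t_def)
  have "t ^ a / fact a \<le> exp t"
  proof -
    have "t ^ a / fact a \<le> (\<Sum>k. t ^ k / fact k)"
      using sum_le_suminf[OF summable_exp_generic[of t], of "{a}"] t(1)
      by (simp add: divide_inverse mult.commute)
    thus ?thesis by (simp add: exp_def divide_inverse mult.commute)
  qed
  hence 1: "t ^ a \<le> fact a * exp t" by (simp add: field_simps)
  have "0 \<le> c * (t - 3 / (2 * c))\<^sup>2" using assms by simp
  also have "\<dots> = c * t\<^sup>2 - 3 * t + 9 / (4 * c)"
    using assms by (simp add: power2_eq_square field_simps)
  finally have 2: "t - c * t\<^sup>2 \<le> 9 / (4 * c) - t" using t(1) by linarith
  have 3: "- t \<le> \<bar>s\<bar> - \<bar>of_int m\<bar>" unfolding t_def by linarith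
  have "t ^ a * exp (- c * t\<^sup>2) \<le> fact a * exp t * exp (- c * t\<^sup>2)"
    using 1 by (intro mult_right_mono) auto
  also have "\<dots> = fact a * exp (t - c * t\<^sup>2)" by (simp add: exp_diff exp_minus field_simps)
  also have "\<dots> \<le> fact a * exp (9 / (4 * c) + \<bar>s\<bar> - \<bar>of_int m\<bar>)"
    using 2 3 by (intro mult_left_mono) auto
  also have "\<dots> = ?K * exp (- \<bar>of_int m\<bar> :: real)"
    by (simp add: exp_add exp_diff exp_minus field_simps)
  finally show "\<bar>of_int m + s\<bar> ^ a * exp (- c * (of_int m + s)\<^sup>2) \<le> ?K * exp (- \<bar>of_int m\<bar> :: real)"
    unfolding t(2) by (simp add: t_def)
qed auto

lemma abs_summable_theta_term:
  assumes "Im z > 0"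
  shows "(\<lambda>m. norm (theta_term b s a z m)) summable_on UNIV"
  unfolding norm_theta_term
  using summable_on_power_gauss[of "pi * Im z" s a] assms by simp

lemma summable_theta_term: "Im z > 0 \<Longrightarrow> theta_term b s a z summable_on UNIV"
  using abs_summable_theta_term abs_summable_summable by blast

text \<open>Takes the place of locally uniform convergence in termwise differentiation: one
  second-order remainder bound, summed over the series, yields the derivative of the sum.\<close>

lemma has_field_derivative_of_quadratic_bound:
  fixes f :: "complex \<Rightarrow> complex"
  assumes "r > 0" "\<And>h. norm h < r \<Longrightarrow> norm (f (z + h) - f z - h * D) \<le> C * (norm h)\<^sup>2"
  shows "(f has_field_derivative D) (at z)"
  unfolding DERIV_def
proof (rule Lim_transform_within [where d = 1])
  have "((\<lambda>h. (f (z + h) - f z - h * D) / h) \<longlongrightarrow> 0) (at 0)"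
  proof (rule Lim_null_comparison)
    show "\<forall>\<^sub>F h in at 0. norm ((f (z + h) - f z - h * D) / h) \<le> C * norm h"
      unfolding eventually_at using assms
      by (intro exI[of _ r]) (auto simp: norm_divide divide_simps power2_eq_square mult.assoc)
    show "((\<lambda>h. C * norm h) \<longlongrightarrow> 0) (at (0::complex))"
      by (rule tendsto_eq_intros refl)+ simp
  qed
  from tendsto_add[OF this tendsto_const[of D]]
  show "((\<lambda>h. (f (z + h) - f z - h * D) / h + D) \<longlongrightarrow> D) (at 0)" by simp
qed (auto simp: field_simps)

lemma has_sum_diff:
  fixes f g :: "'a \<Rightarrow> 'b :: real_normed_vector"
  assumes "(f has_sum a) A" "(g has_sum b) A"
  shows "((\<lambda>x. f x - g x) has_sum (a - b)) A"
  using has_sum_add[OF assms(1), of "\<lambda>x. - g x" "- b"] assms(2) by (simp add: has_sum_uminus)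

lemma theta_moment_has_derivative:
  assumes "Im z > 0"
  shows "(theta_moment b s a has_field_derivative \<i> * pi * theta_moment b s (a + 2) z) (at z)"
proof (rule has_field_derivative_of_quadratic_bound)
  define y where "y = Im z"
  let ?x = "\<lambda>m::int. of_int m + s"
  \<comment> \<open>Half of the Gaussian decay is spent on \<open>exp \<bar>Re v\<bar>\<close> in
    the Taylor remainder, which |h| < y/2 permits; the other half is kept here. The quadratic
    remainder adds (m + s)^4 to the power.\<close>
  let ?g = "\<lambda>m. \<bar>?x m\<bar> ^ (a + 4) * exp (- (pi * y / 2) * (?x m)\<^sup>2)"
  show "0 < y / 2" using assms by (simp add: y_def)
  fix h :: complex assume h: "norm h < y / 2"
  have zh: "Im (z + h) > 0" using h abs_Im_le_cmod[of h] assms unfolding y_def by simp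
  let ?d = "\<lambda>m. theta_term b s a (z + h) m - theta_term b s a z m - h * (\<i> * pi * theta_term b s (a + 2) z m)"
  have sumg: "?g summable_on UNIV"
    using summable_on_power_gauss[of "pi * y / 2" s "a + 4"] assms by (simp add: y_def)
  have bound: "norm (?d m) \<le> pi\<^sup>2 * (norm h)\<^sup>2 * ?g m" for m
  proof -
    define v where "v = \<i> * pi * h * of_real ((?x m)\<^sup>2)"
    have nv: "norm v = pi * norm h * (?x m)\<^sup>2"
      by (simp add: v_def norm_mult del: of_real_power of_real_add of_real_of_int_eq)
    have rv: "\<bar>Re v\<bar> \<le> pi * y / 2 * (?x m)\<^sup>2"
    proof -
      have "\<bar>Re v\<bar> \<le> norm v" by (rule abs_Re_le_cmod)
      also have "\<dots> \<le> pi * (y / 2) * (?x m)\<^sup>2" unfolding nv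
        using h by (intro mult_right_mono mult_left_mono) auto
      finally show ?thesis by simp
    qed
    have "?d m = theta_term b s a z m * (exp v - (\<Sum>k\<le>1. v ^ k / fact k))"
      unfolding theta_term_def v_def
      by (simp add: ring_distribs exp_add power_add power2_eq_square algebra_simps)
    hence "norm (?d m) = norm (theta_term b s a z m) * norm (exp v - (\<Sum>k\<le>1. v ^ k / fact k))"
      by (simp only: norm_mult)
    also have "\<dots> \<le> norm (theta_term b s a z m) * (exp \<bar>Re v\<bar> * norm v ^ 2)"
      using Taylor_exp[of v 1] by (intro mult_left_mono) (auto simp: numeral_2_eq_2)
    also have "\<dots> \<le> norm (theta_term b s a z m) * (exp (pi * y / 2 * (?x m)\<^sup>2) * norm v ^ 2)"
      using rv by (intro mult_left_mono mult_right_mono) auto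
    also have "\<dots> = pi\<^sup>2 * (norm h)\<^sup>2 * (\<bar>?x m\<bar> ^ a * ((?x m)\<^sup>2)\<^sup>2 *
        (exp (- pi * y * (?x m)\<^sup>2) * exp (pi * y / 2 * (?x m)\<^sup>2)))"
      unfolding norm_theta_term nv y_def by (simp add: power_mult_distrib)
    also have "exp (- pi * y * (?x m)\<^sup>2) * exp (pi * y / 2 * (?x m)\<^sup>2) = exp (- (pi * y / 2) * (?x m)\<^sup>2)"
      by (simp add: exp_add [symmetric])
    also have "\<bar>?x m\<bar> ^ a * ((?x m)\<^sup>2)\<^sup>2 = \<bar>?x m\<bar> ^ (a + 4)"
    proof -
      have "((?x m)\<^sup>2)\<^sup>2 = \<bar>?x m\<bar> ^ 4" by (simp flip: power_mult)
      thus ?thesis by (simp only: power_add)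
    qed
    finally show ?thesis .
  qed
  have sumd: "(\<lambda>m. norm (?d m)) summable_on UNIV"
    by (rule summable_on_comparison_test[OF summable_on_cmult_right[OF sumg, of "pi\<^sup>2 * (norm h)\<^sup>2"]])
      (use bound in auto)
  have "theta_moment b s a (z + h) - theta_moment b s a z - h * (\<i> * pi * theta_moment b s (a + 2) z) = infsum ?d UNIV"
  proof (rule sym, rule infsumI)
    show "(?d has_sum (theta_moment b s a (z + h) - theta_moment b s a z - h * (\<i> * pi * theta_moment b s (a + 2) z))) UNIV"
      unfolding theta_moment_def
      by (intro has_sum_diff has_sum_cmult_right has_sum_infsum summable_theta_term assms zh)
  qed
  also have "norm \<dots> \<le> (\<Sum>\<^sub>\<infinity>m. norm (?d m))"
    by (rule norm_infsum_bound) (use sumd in simp)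
  also have "\<dots> \<le> (\<Sum>\<^sub>\<infinity>m. pi\<^sup>2 * (norm h)\<^sup>2 * ?g m)"
    by (intro infsum_mono sumd summable_on_cmult_right sumg bound)
  also have "\<dots> = (pi\<^sup>2 * infsum ?g UNIV) * (norm h)\<^sup>2"
    by (subst infsum_cmult_right') (simp add: algebra_simps)
  finally show "norm (theta_moment b s a (z + h) - theta_moment b s a z - h * (\<i> * pi * theta_moment b s (a + 2) z)) \<le> (pi\<^sup>2 * infsum ?g UNIV) * (norm h)\<^sup>2" .
qed

text \<open>Each term is at most its absolute value at z = i times exp (- pi (Im z - 1)), because
  its exponent is at least 1; the whole series inherits that factor.\<close>

lemma norm_exp_series_le:
  fixes w :: "int \<Rightarrow> complex" and e :: "int \<Rightarrow> real"
  assumes e: "\<And>m. w m \<noteq> 0 \<Longrightarrow> e m \<ge> 1"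
    and sum: "(\<lambda>m. norm (w m) * exp (- pi * e m)) summable_on UNIV"
    and z: "Im z \<ge> 1"
  shows "norm (\<Sum>\<^sub>\<infinity>m. w m * exp (\<i> * pi * z * of_real (e m)))
           \<le> exp (- pi * (Im z - 1)) * (\<Sum>\<^sub>\<infinity>m. norm (w m) * exp (- pi * e m))"
proof -
  let ?f = "\<lambda>m. w m * exp (\<i> * pi * z * of_real (e m))"
  have bound: "norm (?f m) \<le> exp (- pi * (Im z - 1)) * (norm (w m) * exp (- pi * e m))" for m
  proof (cases "w m = 0")
    case False
    have "Im z - 1 \<le> (Im z - 1) * e m"
      using e[OF False] z mult_left_mono[of 1 "e m" "Im z - 1"] by simp
    hence "pi * (Im z - 1) \<le> pi * ((Im z - 1) * e m)" by (intro mult_left_mono) auto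
    hence "- pi * Im z * e m \<le> - pi * (Im z - 1) + - pi * e m" by (simp add: algebra_simps)
    hence "exp (- pi * Im z * e m) \<le> exp (- pi * (Im z - 1)) * exp (- pi * e m)"
      unfolding exp_add [symmetric] by simp
    thus ?thesis by (simp add: norm_mult mult.left_commute mult_left_mono)
  qed simp
  have sumf: "(\<lambda>m. norm (?f m)) summable_on UNIV"
    by (rule summable_on_comparison_test[OF summable_on_cmult_right[OF sum, of "exp (- pi * (Im z - 1))"]])
      (use bound in auto)
  have "norm (infsum ?f UNIV) \<le> (\<Sum>\<^sub>\<infinity>m. norm (?f m))"
    by (rule norm_infsum_bound) (use sumf in simp)
  also have "\<dots> \<le> (\<Sum>\<^sub>\<infinity>m. exp (- pi * (Im z - 1)) * (norm (w m) * exp (- pi * e m)))"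
    by (intro infsum_mono sumf summable_on_cmult_right sum bound)
  also have "\<dots> = exp (- pi * (Im z - 1)) * (\<Sum>\<^sub>\<infinity>m. norm (w m) * exp (- pi * e m))"
    by (rule infsum_cmult_right')
  finally show ?thesis .
qed

text \<open>The reflection m -> k - m turns the sum into its negative. It is used with k = 0 over
  the integers and k = -1 over the half-integers, where it realises x -> -x.\<close>

lemma infsum_eq_0_if_antisymmetric:
  fixes f :: "int \<Rightarrow> complex"
  assumes "\<And>m. f (k - m) = - f m"
  shows "infsum f UNIV = 0"
proof -
  have "infsum f UNIV = infsum (\<lambda>m. - f m) UNIV"
    by (rule infsum_reindex_bij_witness[of _ "\<lambda>m. k - m" "\<lambda>m. k - m"]) (auto simp: assms)
  thus ?thesis by (simp add: infsum_uminus)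
qed

lemma theta_moment_odd_int: "odd a \<Longrightarrow> theta_moment b 0 a z = 0"
  unfolding theta_moment_def
  by (rule infsum_eq_0_if_antisymmetric[of _ 0]) (simp add: theta_term_def)

lemma theta_moment_odd_half:
  assumes "odd a"
  shows "theta_moment False (1/2) a z = 0"
  unfolding theta_moment_def
proof (rule infsum_eq_0_if_antisymmetric[of _ "-1"])
  fix m :: int
  define x where "x = (of_int m + 1/2 :: real)"
  have *: "of_int (- 1 - m) + 1/2 = - x" by (simp add: x_def)
  show "theta_term False (1/2) a z (- 1 - m) = - theta_term False (1/2) a z m"
    unfolding theta_term_def * x_def [symmetric] using assms by simp
qed

text \<open>The reflection x -> -x of the half-integers sends m to -1 - m, which has the other
  parity. So the sign flips, while the even power and the Gaussian do not change.\<close>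

lemma theta_moment_even_half_twisted:
  assumes "even a"
  shows "theta_moment True (1/2) a z = 0"
  unfolding theta_moment_def
proof (rule infsum_eq_0_if_antisymmetric[of _ "-1"])
  fix m :: int
  define x where "x = (of_int m + 1/2 :: real)"
  have *: "of_int (- 1 - m) + 1/2 = - x" by (simp add: x_def)
  show "theta_term True (1/2) a z (- 1 - m) = - theta_term True (1/2) a z m"
    unfolding theta_term_def * x_def [symmetric] using assms by (simp add: twist_def)
qed

text \<open>Landen's transformation adds 1/2 to the shift, so that \<open>theta2\<close> leads to s
  = 1.\<close>

lemma theta_moment_shift: "theta_moment False 1 a z = theta_moment False 0 a z"
  unfolding theta_moment_def
  by (rule infsum_reindex_bij_witness[of _ "\<lambda>m. m - 1" "\<lambda>m. m + 1"]) (auto simp: theta_term_def)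

lemma theta2_eq: "theta2 z = theta_moment False (1/2) 0 z"
  by (simp add: theta2_def theta_moment_def theta_term_def)

lemma theta3_eq: "theta3 z = theta_moment False 0 0 z"
  unfolding theta3_def theta_moment_def
  by (rule infsum_cong) (simp add: theta_term_def exp_of_nat_mult [symmetric] mult_ac)

lemma theta4_eq: "theta4 z = theta_moment True 0 0 z"
  unfolding theta4_def theta_moment_def
proof (rule infsum_cong)
  fix m :: int
  have "even (nat (m\<^sup>2)) \<longleftrightarrow> even m" by (simp add: even_nat_iff)
  thus "(- exp (\<i> * pi * z)) ^ nat (m\<^sup>2) = theta_term True 0 0 z m"
    by (auto simp add: theta_term_def twist_def exp_of_nat_mult [symmetric] mult_ac power_minus_odd)
qed

subsection \<open>Landen's transformation\<close>

lemma has_sum_product: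
  fixes f g :: "'a \<Rightarrow> complex"
  assumes f: "(\<lambda>x. norm (f x)) summable_on A" and g: "(\<lambda>x. norm (g x)) summable_on B"
  shows "((\<lambda>(x, y). f x * g y) has_sum (infsum f A * infsum g B)) (A \<times> B)"
proof -
  have "(\<lambda>p. norm (case p of (x, y) \<Rightarrow> f x * g y)) summable_on (A \<times> B)"
    unfolding Infinite_Sum.abs_summable_on_Sigma_iff
    using summable_on_cmult_left[OF f] summable_on_cmult_right[OF g]
    by (auto simp: norm_mult infsum_cmult_right' abs_mult infsum_nonneg)
  hence *: "(\<lambda>(x, y). f x * g y) summable_on (A \<times> B)"
    by (rule abs_summable_summable)
  have "infsum (\<lambda>(x, y). f x * g y) (A \<times> B) = (\<Sum>\<^sub>\<infinity>x\<in>A. \<Sum>\<^sub>\<infinity>y\<in>B. f x * g y)"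
    using infsum_Sigma'_banach[of "\<lambda>x y. f x * g y" A "\<lambda>_. B"] * by simp
  also have "\<dots> = infsum f A * infsum g B"
    by (simp add: infsum_cmult_right' infsum_cmult_left')
  finally show ?thesis using has_sum_infsum[OF *] by simp
qed

text \<open>Pairs with even and with odd coordinate sum are the two cosets of the sublattice
  generated by (1, 1) and (1, -1), so each class is parametrised by free integers m and k.\<close>

lemma has_sum_rotate_int_pairs:
  fixes F :: "int \<times> int \<Rightarrow> complex"
  assumes 1: "((\<lambda>(m, k). F (m + k, m - k)) has_sum S) UNIV"
    and 2: "((\<lambda>(m, k). F (m + k + 1, m - k)) has_sum T) UNIV"
  shows "(F has_sum (S + T)) UNIV"
proof -
  let ?p = "\<lambda>(m, k). (m + k, m - k) :: int \<times> int" and ?q = "\<lambda>(m, k). (m + k + 1, m - k) :: int \<times> int"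
  have "(F has_sum (S + T)) (range ?p \<union> range ?q)"
  proof (rule has_sum_Un_disjoint)
    have inj: "inj ?p" "inj ?q" by (auto simp: inj_on_def)
    show "(F has_sum S) (range ?p)" "(F has_sum T) (range ?q)"
      unfolding has_sum_reindex[OF inj(1)] has_sum_reindex[OF inj(2)]
      using 1 2 by (simp_all add: case_prod_unfold o_def)
    have "even (fst x + snd x)" if "x \<in> range ?p" for x using that by auto
    moreover have "odd (fst x + snd x)" if "x \<in> range ?q" for x using that by auto
    ultimately show "range ?p \<inter> range ?q = {}" by blast
  qed
  also have "range ?p \<union> range ?q = UNIV"
  proof (intro set_eqI iffI UNIV_I)
    fix x :: "int \<times> int"
    obtain m k where x: "x = (m, k)" by fastforce
    show "x \<in> range ?p \<union> range ?q"
    proof (cases "even (m + k)")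
      case True
      then obtain c where "m + k = 2 * c" by (elim evenE)
      hence "x = ?p (c, c - k)" by (auto simp: x)
      thus ?thesis by blast
    next
      case False
      then obtain c where "m + k = 2 * c + 1" by (elim oddE)
      hence "x = ?q (c, c - k)" by (auto simp: x)
      thus ?thesis by blast
    qed
  qed
  finally show ?thesis .
qed

lemma has_sum_theta_product:
  assumes "Im z > 0"
  shows "((\<lambda>(m, k). theta_term b s a z m * theta_term b' s' a' z k) has_sum
     (theta_moment b s a z * theta_moment b' s' a' z)) UNIV"
  using has_sum_product[OF abs_summable_theta_term[OF assms] abs_summable_theta_term[OF assms]]
  by (simp add: theta_moment_def)

text \<open>The lattice \<open>\<int>\<^sup>2\<close> is rotated by 45 degrees.\<close>

lemma theta_landen:
  assumes z: "Im z > 0" and c: "c = (b \<noteq> b')"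
  shows "theta_moment b s 0 z * theta_moment b' s 0 z =
     theta_moment c s 0 (2 * z) * theta_moment c 0 0 (2 * z) +
     twist b 1 * (theta_moment c (s + 1/2) 0 (2 * z) * theta_moment c (1/2) 0 (2 * z))"
proof -
  let ?F = "\<lambda>(m, k). theta_term b s 0 z m * theta_term b' s 0 z k"
  have z2: "Im (2 * z) > 0" using z by simp
  \<comment> \<open>The side condition will be the parallelogram law (m + k + s)^2 + (m - k + s)^2 =
    2 (m + s)^2 + 2 k^2, or its analogue with m + 1/2 and k + 1/2 on the odd coset. The factor 2 is
    what turns z into 2 z.\<close>
  have ee: "exp (\<i> * pi * z * of_real x) * exp (\<i> * pi * z * of_real y) =
      exp (\<i> * pi * (2 * z) * of_real u) * exp (\<i> * pi * (2 * z) * of_real v)"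
    if "x + y = 2 * u + 2 * v" for x y u v
  proof -
    have "\<i> * pi * z * of_real x + \<i> * pi * z * of_real y = \<i> * pi * z * of_real (x + y)"
      by (simp add: algebra_simps)
    also have "\<dots> = \<i> * pi * (2 * z) * of_real u + \<i> * pi * (2 * z) * of_real v"
      unfolding that by (simp add: algebra_simps)
    finally show ?thesis by (simp only: exp_add [symmetric])
  qed
  \<comment> \<open>m + k and m - k have the same parity, so two signs cancel and a single one
    leaves (-1)^(m + k).\<close>
  have tw: "twist b (m + k) * twist b' (m - k) = twist c m * twist c k" for m k
    by (auto simp: twist_def c)
  have "(?F has_sum (theta_moment c s 0 (2 * z) * theta_moment c 0 0 (2 * z) +
     twist b 1 * (theta_moment c (s + 1/2) 0 (2 * z) * theta_moment c (1/2) 0 (2 * z)))) UNIV"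
  proof (rule has_sum_rotate_int_pairs)
    have "theta_term b s 0 z (m + k) * theta_term b' s 0 z (m - k) =
      theta_term c s 0 (2 * z) m * theta_term c 0 0 (2 * z) k" for m k
    proof -
      have "theta_term b s 0 z (m + k) * theta_term b' s 0 z (m - k) = (twist b (m + k) * twist b' (m - k)) *
         (exp (\<i> * pi * z * of_real ((of_int (m + k) + s)\<^sup>2)) * exp (\<i> * pi * z * of_real ((of_int (m - k) + s)\<^sup>2)))"
        unfolding theta_term_def by (simp add: mult_ac)
      also have "\<dots> = (twist c m * twist c k) * (exp (\<i> * pi * (2 * z) * of_real ((of_int m + s)\<^sup>2)) *
          exp (\<i> * pi * (2 * z) * of_real ((of_int k + 0)\<^sup>2)))"
        unfolding tw by (rule arg_cong[OF ee]) (simp add: power2_eq_square algebra_simps)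
      also have "\<dots> = theta_term c s 0 (2 * z) m * theta_term c 0 0 (2 * z) k"
        unfolding theta_term_def by (simp add: mult_ac)
      finally show ?thesis .
    qed
    thus "((\<lambda>(m, k). ?F (m + k, m - k)) has_sum (theta_moment c s 0 (2 * z) * theta_moment c 0 0 (2 * z))) UNIV"
      using has_sum_theta_product[OF z2] by simp
    have "theta_term b s 0 z (m + k + 1) * theta_term b' s 0 z (m - k) =
      twist b 1 * (theta_term c (s + 1/2) 0 (2 * z) m * theta_term c (1/2) 0 (2 * z) k)" for m k
    proof -
      have "theta_term b s 0 z (m + k + 1) * theta_term b' s 0 z (m - k) = twist b 1 * ((twist b (m + k) * twist b' (m - k)) *
         (exp (\<i> * pi * z * of_real ((of_int (m + k + 1) + s)\<^sup>2)) * exp (\<i> * pi * z * of_real ((of_int (m - k) + s)\<^sup>2))))"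
        unfolding theta_term_def by (simp only: mult_ac twist_add) simp
      also have "\<dots> = twist b 1 * ((twist c m * twist c k) * (exp (\<i> * pi * (2 * z) * of_real ((of_int m + (s + 1/2))\<^sup>2)) *
          exp (\<i> * pi * (2 * z) * of_real ((of_int k + 1/2)\<^sup>2))))"
        unfolding tw by (rule arg_cong[OF ee]) (simp add: power2_eq_square algebra_simps)
      also have "\<dots> = twist b 1 * (theta_term c (s + 1/2) 0 (2 * z) m * theta_term c (1/2) 0 (2 * z) k)"
        unfolding theta_term_def by (simp add: mult_ac)
      finally show ?thesis .
    qed
    thus "((\<lambda>(m, k). ?F (m + k + 1, m - k)) has_sum
       (twist b 1 * (theta_moment c (s + 1/2) 0 (2 * z) * theta_moment c (1/2) 0 (2 * z)))) UNIV"
      using has_sum_cmult_right[OF has_sum_theta_product[OF z2], of "twist b 1"]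
      by (simp add: case_prod_unfold)
  qed
  moreover have "(?F has_sum (theta_moment b s 0 z * theta_moment b' s 0 z)) UNIV"
    by (rule has_sum_theta_product[OF z])
  ultimately show ?thesis by (metis (no_types, lifting) has_sum_unique)
qed

lemma theta2_squared: "Im z > 0 \<Longrightarrow> theta2 z ^ 2 = 2 * theta2 (2 * z) * theta3 (2 * z)"
  using theta_landen[of z False False False "1/2"]
  by (simp add: theta2_eq theta3_eq theta_moment_shift power2_eq_square)

lemma theta3_squared: "Im z > 0 \<Longrightarrow> theta3 z ^ 2 = theta3 (2 * z) ^ 2 + theta2 (2 * z) ^ 2"
  using theta_landen[of z False False False 0]
  by (simp add: theta2_eq theta3_eq power2_eq_square)

lemma theta4_squared: "Im z > 0 \<Longrightarrow> theta4 z ^ 2 = theta3 (2 * z) ^ 2 - theta2 (2 * z) ^ 2"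
  using theta_landen[of z False True True 0]
  by (simp add: theta2_eq theta3_eq theta4_eq twist_def power2_eq_square)

lemma theta3_times_theta4: "Im z > 0 \<Longrightarrow> theta3 z * theta4 z = theta4 (2 * z) ^ 2"
  using theta_landen[of z True False True 0]
  by (simp add: theta3_eq theta4_eq theta_moment_even_half_twisted power2_eq_square)

subsection \<open>Behaviour at the cusp\<close>

text \<open>Limits along this filter are uniform in Re z, which matters because doubling z stretches
  Re z too.\<close>

abbreviation at_cusp :: "complex filter" where
  "at_cusp \<equiv> filtercomap Im at_top"

lemma eventually_at_cusp: "eventually (\<lambda>z. Im z \<ge> c) at_cusp"
  unfolding eventually_filtercomap using eventually_ge_at_top by blast

text \<open>The value is constant along the orbit 2^k z, which runs into the cusp, so it already
  equals the limit.\<close>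

lemma doubling_invariant_eq_limit:
  fixes f :: "complex \<Rightarrow> 'a :: t2_space"
  assumes inv: "\<And>z. Im z > 0 \<Longrightarrow> f z = f (2 * z)"
    and lim: "(f \<longlongrightarrow> l) at_cusp" and z: "Im z > 0"
  shows "f z = l"
proof -
  have *: "f (2 ^ k * z) = f z" for k
  proof (induction k)
    case (Suc k)
    have "Im (2 ^ k * z) = 2 ^ k * Im z" by (induction k) (auto simp: algebra_simps)
    hence "f (2 ^ k * z) = f (2 * (2 ^ k * z))" using z by (intro inv) simp
    thus ?case using Suc by (simp add: mult_ac)
  qed simp
  have "filterlim (\<lambda>k. 2 ^ k * z) at_cusp sequentially"
    unfolding filterlim_filtercomap_iff o_def
  proof -
    have "Im (2 ^ k * z) = 2 ^ k * Im z" for k by (induction k) (auto simp: algebra_simps)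
    moreover have "filterlim (\<lambda>k. 2 ^ k * Im z) at_top sequentially"
    proof (rule filterlim_at_top_mult_tendsto_pos[OF tendsto_const z])
      show "filterlim (\<lambda>k. 2 ^ k :: real) at_top sequentially"
        by (rule filterlim_at_top_mono[OF filterlim_real_sequentially])
          (simp add: of_nat_less_two_power less_imp_le)
    qed
    ultimately show "filterlim (\<lambda>k. Im (2 ^ k * z)) at_top sequentially" by simp
  qed
  from filterlim_compose[OF lim this] have "(\<lambda>k. f z) \<longlonglongrightarrow> l" by (simp add: *)
  thus ?thesis by (simp add: LIMSEQ_const_iff)
qed

text \<open>The exponential factor from \<open>norm_exp_series_le\<close> beats every power of Im z.
  The weight is used with k = 2 for the Halphen defect.\<close>

lemma exp_series_decay:
  fixes w :: "int \<Rightarrow> complex" and e :: "int \<Rightarrow> real"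
  assumes e: "\<And>m. w m \<noteq> 0 \<Longrightarrow> e m \<ge> 1"
    and sum: "(\<lambda>m. norm (w m) * exp (- pi * e m)) summable_on UNIV"
  shows "((\<lambda>z. of_real (Im z) ^ k * (\<Sum>\<^sub>\<infinity>m. w m * exp (\<i> * pi * z * of_real (e m)))) \<longlongrightarrow> 0) at_cusp"
proof (rule Lim_null_comparison)
  let ?S = "\<Sum>\<^sub>\<infinity>m. norm (w m) * exp (- pi * e m)"
  show "\<forall>\<^sub>F z in at_cusp. norm (of_real (Im z) ^ k * (\<Sum>\<^sub>\<infinity>m. w m * exp (\<i> * pi * z * of_real (e m))))
     \<le> (Im z ^ k / exp (Im z)) * (exp pi * ?S)"
    using eventually_at_cusp[of 1]
  proof eventually_elim
    case (elim z)
    have S: "?S \<ge> 0" by (intro infsum_nonneg) auto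
    have "norm (of_real (Im z) ^ k * (\<Sum>\<^sub>\<infinity>m. w m * exp (\<i> * pi * z * of_real (e m))))
       \<le> Im z ^ k * (exp (- pi * (Im z - 1)) * ?S)"
      using norm_exp_series_le[OF e sum elim] elim
      by (auto simp: norm_mult norm_power intro!: mult_left_mono)
    also have "exp (- pi * (Im z - 1)) \<le> exp (- Im z) * exp pi"
    proof -
      have "1 * Im z \<le> pi * Im z" using elim pi_gt3 by (intro mult_right_mono) auto
      thus ?thesis by (simp add: exp_add [symmetric] algebra_simps)
    qed
    finally show ?case using elim S
      by (simp add: exp_minus field_simps mult_left_mono mult_right_mono)
  qed
  have "((\<lambda>x::real. (x ^ k / exp x) * (exp pi * ?S)) \<longlongrightarrow> 0 * (exp pi * ?S)) at_top"
    by (intro tendsto_mult tendsto_power_div_exp_0 tendsto_const)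
  thus "((\<lambda>z. (Im z ^ k / exp (Im z)) * (exp pi * ?S)) \<longlongrightarrow> 0) at_cusp"
    using filterlim_compose[OF _ filterlim_filtercomap[of Im at_top]] by fastforce
qed

lemma theta_moment_decay:
  assumes "a > 0"
  shows "((\<lambda>z. of_real (Im z) ^ k * theta_moment b 0 a z) \<longlongrightarrow> 0) at_cusp"
proof -
  have "((\<lambda>z. of_real (Im z) ^ k * (\<Sum>\<^sub>\<infinity>m. (twist b m * of_real (of_int m ^ a)) *
     exp (\<i> * pi * z * of_real ((of_int m)\<^sup>2)))) \<longlongrightarrow> 0) at_cusp"
  proof (rule exp_series_decay)
    fix m :: int
    assume "twist b m * of_real (of_int m ^ a) \<noteq> 0"
    hence "m \<noteq> 0" using assms by auto
    hence "1 \<le> m\<^sup>2" by (simp add: int_one_le_iff_zero_less)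
    thus "1 \<le> (of_int m :: real)\<^sup>2" by (metis of_int_1_le_iff of_int_power)
  next
    show "(\<lambda>m. norm (twist b m * of_real (of_int m ^ a)) * exp (- pi * (of_int m)\<^sup>2)) summable_on UNIV"
      using summable_on_power_gauss[of pi 0 a] by (simp add: norm_mult norm_power)
  qed
  thus ?thesis by (simp add: theta_moment_def theta_term_def)
qed

lemma has_sum_finite_support:
  fixes f :: "'a \<Rightarrow> complex"
  assumes "finite A"
  shows "((\<lambda>m. if m \<in> A then f m else 0) has_sum sum f A) UNIV"
  by (subst has_sum_cong_neutral[where T = A and g = f]) (use assms in \<open>auto simp: has_sum_finite\<close>)

lemma theta_moment_tendsto_1: "(theta_moment b 0 0 \<longlongrightarrow> 1) at_cusp"
proof -
  \<comment> \<open>The term m = 0 is the limit 1; deleting it leaves only exponents m^2 >=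
    1.\<close>
  let ?w = "\<lambda>m. if m \<in> {0} then 0 else twist b m"
  have *: "((\<lambda>z. of_real (Im z) ^ 0 * (\<Sum>\<^sub>\<infinity>m. ?w m * exp (\<i> * pi * z * of_real ((of_int m)\<^sup>2)))) \<longlongrightarrow> 0) at_cusp"
  proof (rule exp_series_decay)
    fix m :: int
    assume "?w m \<noteq> 0"
    hence "m \<noteq> 0" by (auto split: if_splits)
    hence "1 \<le> m\<^sup>2" by (simp add: int_one_le_iff_zero_less)
    thus "1 \<le> (of_int m :: real)\<^sup>2" by (metis of_int_1_le_iff of_int_power)
  next
    show "(\<lambda>m. norm (?w m) * exp (- pi * (of_int m)\<^sup>2)) summable_on UNIV"
      by (rule summable_on_comparison_test[OF summable_on_power_gauss[of pi 0 0]]) auto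
  qed
  have "(\<Sum>\<^sub>\<infinity>m. ?w m * exp (\<i> * pi * z * of_real ((of_int m)\<^sup>2))) = theta_moment b 0 0 z - 1"
    if "Im z \<ge> 1" for z
  proof (rule infsumI)
    have "((\<lambda>m. theta_term b 0 0 z m - (if m \<in> {0} then 1 else 0)) has_sum
        (theta_moment b 0 0 z - sum (\<lambda>_. 1) {0::int})) UNIV"
      unfolding theta_moment_def using that
      by (intro has_sum_diff has_sum_infsum summable_theta_term has_sum_finite_support) auto
    also have "(\<lambda>m. theta_term b 0 0 z m - (if m \<in> {0} then 1 else 0)) =
        (\<lambda>m. ?w m * exp (\<i> * pi * z * of_real ((of_int m)\<^sup>2)))"
      by (auto simp: theta_term_def twist_def fun_eq_iff)
    finally show "((\<lambda>m. ?w m * exp (\<i> * pi * z * of_real ((of_int m)\<^sup>2))) has_sum (theta_moment b 0 0 z - 1)) UNIV"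
      by simp
  qed
  hence "\<forall>\<^sub>F z in at_cusp. of_real (Im z) ^ 0 * (\<Sum>\<^sub>\<infinity>m. ?w m * exp (\<i> * pi * z * of_real ((of_int m)\<^sup>2))) =
      theta_moment b 0 0 z - 1"
    using eventually_at_cusp[of 1] by (auto elim: eventually_mono)
  from tendsto_cong[OF this] * have "((\<lambda>z. theta_moment b 0 0 z - 1) \<longlongrightarrow> 0) at_cusp" by blast
  thus ?thesis by (simp add: LIM_zero_iff)
qed

text \<open>\<open>theta2\<close> itself tends to 0, so its leading power q^(1/4) is divided out.
  That power comes from m = -1 and m = 0; for all other m the remaining exponent m (m + 1) is
  positive.\<close>

lemma theta_moment_half_tendsto:
  "((\<lambda>z. exp (- (\<i> * pi * z / 4)) * theta_moment False (1/2) a z) \<longlongrightarrow>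
     (\<Sum>m\<in>{-1, 0}. of_real ((of_int m + 1/2) ^ a))) at_cusp"
proof -
  let ?A = "{-1, 0} :: int set"
  let ?x = "\<lambda>m::int. of_int m + 1/2 :: real"
  let ?w = "\<lambda>m. if m \<in> ?A then 0 else complex_of_real (?x m ^ a)"
  let ?e = "\<lambda>m. (?x m)\<^sup>2 - 1/4"
  have e: "?e m = of_int (m * (m + 1))" for m by (simp add: power2_eq_square algebra_simps)
  have *: "((\<lambda>z. of_real (Im z) ^ 0 * (\<Sum>\<^sub>\<infinity>m. ?w m * exp (\<i> * pi * z * of_real (?e m)))) \<longlongrightarrow> 0) at_cusp"
  proof (rule exp_series_decay)
    fix m :: int
    assume "?w m \<noteq> 0"
    hence "m > 0 \<or> m + 1 < 0" by (auto split: if_splits)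
    hence "0 < m * (m + 1)" by (auto intro: mult_neg_neg)
    hence "1 \<le> m * (m + 1)" by linarith
    thus "1 \<le> ?e m" unfolding e by (simp only: of_int_1_le_iff)
  next
    show "(\<lambda>m. norm (?w m) * exp (- pi * ?e m)) summable_on UNIV"
    proof (rule summable_on_comparison_test)
      show "(\<lambda>m. exp (pi / 4) * (\<bar>?x m\<bar> ^ a * exp (- pi * (?x m)\<^sup>2))) summable_on UNIV"
        by (intro summable_on_cmult_right summable_on_power_gauss) simp
      fix m :: int
      have "exp (- pi * ?e m) = exp (pi / 4) * exp (- pi * (?x m)\<^sup>2)"
        by (simp add: exp_add [symmetric] algebra_simps)
      moreover have "norm (?w m) \<le> \<bar>?x m\<bar> ^ a"
        by (auto simp: norm_power power_abs simp del: of_real_add of_real_of_int_eq)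
      ultimately show "norm (?w m) * exp (- pi * ?e m) \<le> exp (pi / 4) * (\<bar>?x m\<bar> ^ a * exp (- pi * (?x m)\<^sup>2))"
        by (simp add: mult_ac)
    qed auto
  qed
  have "(\<Sum>\<^sub>\<infinity>m. ?w m * exp (\<i> * pi * z * of_real (?e m))) =
      exp (- (\<i> * pi * z / 4)) * theta_moment False (1/2) a z - (\<Sum>m\<in>?A. of_real (?x m ^ a))"
    if "Im z \<ge> 1" for z
  proof (rule infsumI)
    have "((\<lambda>m. exp (- (\<i> * pi * z / 4)) * theta_term False (1/2) a z m -
        (if m \<in> ?A then of_real (?x m ^ a) else 0)) has_sum
        (exp (- (\<i> * pi * z / 4)) * theta_moment False (1/2) a z - (\<Sum>m\<in>?A. of_real (?x m ^ a)))) UNIV"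
      unfolding theta_moment_def using that
      by (intro has_sum_diff has_sum_cmult_right has_sum_infsum summable_theta_term has_sum_finite_support) auto
    also have "(\<lambda>m. exp (- (\<i> * pi * z / 4)) * theta_term False (1/2) a z m -
        (if m \<in> ?A then of_real (?x m ^ a) else 0)) = (\<lambda>m. ?w m * exp (\<i> * pi * z * of_real (?e m)))"
    proof
      fix m
      have "exp (- (\<i> * pi * z / 4)) * theta_term False (1/2) a z m =
          of_real (?x m ^ a) * exp (\<i> * pi * z * of_real (?e m))"
        unfolding theta_term_def by (simp add: exp_add [symmetric] algebra_simps flip: exp_minus)
      moreover have "?e m = 0" if "m \<in> ?A" using that by (auto simp: power2_eq_square)
      ultimately show "exp (- (\<i> * pi * z / 4)) * theta_term False (1/2) a z m -
        (if m \<in> ?A then of_real (?x m ^ a) else 0) = ?w m * exp (\<i> * pi * z * of_real (?e m))"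
        by (simp only: split: if_splits) (simp add: power2_eq_square)
    qed
    finally show "((\<lambda>m. ?w m * exp (\<i> * pi * z * of_real (?e m))) has_sum
        (exp (- (\<i> * pi * z / 4)) * theta_moment False (1/2) a z - (\<Sum>m\<in>?A. of_real (?x m ^ a)))) UNIV" .
  qed
  hence "\<forall>\<^sub>F z in at_cusp. of_real (Im z) ^ 0 * (\<Sum>\<^sub>\<infinity>m. ?w m * exp (\<i> * pi * z * of_real (?e m))) =
      exp (- (\<i> * pi * z / 4)) * theta_moment False (1/2) a z - (\<Sum>m\<in>?A. of_real (?x m ^ a))"
    using eventually_at_cusp[of 1] by (auto elim: eventually_mono)
  from tendsto_cong[OF this] * have "((\<lambda>z. exp (- (\<i> * pi * z / 4)) * theta_moment False (1/2) a z -
      (\<Sum>m\<in>?A. of_real (?x m ^ a))) \<longlongrightarrow> 0) at_cusp" by blast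
  thus ?thesis by (simp only: LIM_zero_iff)
qed

lemma eventually_theta2_nonzero: "\<forall>\<^sub>F z in at_cusp. theta2 z \<noteq> 0"
proof -
  have "((\<lambda>z. exp (- (\<i> * pi * z / 4)) * theta2 z) \<longlongrightarrow> 2) at_cusp"
    using theta_moment_half_tendsto[of 0] by (simp add: theta2_eq)
  from tendsto_imp_eventually_ne[OF this, of 0] show ?thesis
    by (auto elim: eventually_mono)
qed

text \<open>A zero would propagate along 2^k z into the half-plane near the cusp where
  \<open>f\<close> has no zeros.\<close>

lemma nonzero_if_doubling:
  assumes "\<And>z. Im z > 0 \<Longrightarrow> f z = 0 \<Longrightarrow> f (2 * z) = 0"
    and "\<forall>\<^sub>F z in at_cusp. f z \<noteq> 0" and "Im z > 0"
  shows "f z \<noteq> (0 :: complex)"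
proof
  assume "f z = 0"
  have *: "f (2 ^ k * z) = 0 \<and> Im (2 ^ k * z) = 2 ^ k * Im z" for k
  proof (induction k)
    case (Suc k)
    thus ?case using assms(1)[of "2 ^ k * z"] assms(3) by (simp add: mult_ac)
  qed (use \<open>f z = 0\<close> in simp)
  obtain c where c: "\<And>z. Im z \<ge> c \<Longrightarrow> f z \<noteq> 0"
    using assms(2) by (auto simp: eventually_filtercomap eventually_at_top_linorder)
  obtain k where "2 ^ k > c / Im z" using real_arch_pow[of 2 "c / Im z"] by auto
  hence "c \<le> 2 ^ k * Im z" using assms(3) by (simp add: field_simps)
  thus False using c[of "2 ^ k * z"] * by metis
qed

text \<open>\<open>theta4\<close> comes first because \<open>theta3_times_theta4\<close> passes its
  zeros from z to 2 z. The same relation then excludes zeros of \<open>theta3\<close>, after which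
  \<open>theta2_squared\<close> passes zeros of \<open>theta2\<close> from z to 2 z.\<close>

lemma theta4_nonzero: assumes "Im z > 0" shows "theta4 z \<noteq> 0"
proof (rule nonzero_if_doubling[of theta4, OF _ _ assms])
  show "theta4 (2 * z) = 0" if "Im z > 0" "theta4 z = 0" for z
    using theta3_times_theta4[OF that(1)] that(2) by simp
  have "(theta4 \<longlongrightarrow> 1) at_cusp"
    using theta_moment_tendsto_1[of True] by (simp add: theta4_eq[abs_def])
  from tendsto_imp_eventually_ne[OF this, of 0] show "\<forall>\<^sub>F z in at_cusp. theta4 z \<noteq> 0" by simp
qed

lemma theta3_nonzero: assumes "Im z > 0" shows "theta3 z \<noteq> 0"
  using theta3_times_theta4[OF assms] theta4_nonzero[of "2 * z"] assms by auto

lemma theta2_nonzero: assumes "Im z > 0" shows "theta2 z \<noteq> 0"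
proof (rule nonzero_if_doubling[of theta2, OF _ eventually_theta2_nonzero assms])
  show "theta2 (2 * z) = 0" if "Im z > 0" "theta2 z = 0" for z
    using theta2_squared[OF that(1)] theta3_nonzero[of "2 * z"] that by simp
qed

subsection \<open>Logarithmic derivatives\<close>

text \<open>\<open>has_qderiv f D z\<close> says that \<open>q d/dq\<close>, that is \<open>1 / (\<i> \<pi>) d/dz\<close>, maps \<open>f\<close> to \<open>D\<close> at \<open>z\<close>.\<close>

definition has_qderiv :: "(complex \<Rightarrow> complex) \<Rightarrow> complex \<Rightarrow> complex \<Rightarrow> bool" where
  "has_qderiv f D z \<longleftrightarrow> (f has_field_derivative \<i> * pi * D) (at z)"

lemma has_qderiv_eq_rhs: "has_qderiv f D z \<Longrightarrow> D = D' \<Longrightarrow> has_qderiv f D' z"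
  by simp

lemma has_qderiv_const: "has_qderiv (\<lambda>_. c) 0 z"
  unfolding has_qderiv_def by simp

lemma has_qderiv_add: "has_qderiv f D z \<Longrightarrow> has_qderiv g E z \<Longrightarrow> has_qderiv (\<lambda>z. f z + g z) (D + E) z"
  unfolding has_qderiv_def by (auto intro!: derivative_eq_intros simp: algebra_simps)

lemma has_qderiv_diff: "has_qderiv f D z \<Longrightarrow> has_qderiv g E z \<Longrightarrow> has_qderiv (\<lambda>z. f z - g z) (D - E) z"
  unfolding has_qderiv_def by (auto intro!: derivative_eq_intros simp: algebra_simps)

lemma has_qderiv_mult:
  "has_qderiv f D z \<Longrightarrow> has_qderiv g E z \<Longrightarrow> has_qderiv (\<lambda>z. f z * g z) (D * g z + f z * E) z"
  unfolding has_qderiv_def by (auto intro!: derivative_eq_intros simp: algebra_simps)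

lemma has_qderiv_power:
  "has_qderiv f D z \<Longrightarrow> has_qderiv (\<lambda>z. f z ^ k) (of_nat k * f z ^ (k - 1) * D) z"
  unfolding has_qderiv_def by (auto intro!: derivative_eq_intros simp: algebra_simps)

lemma has_qderiv_divide:
  "has_qderiv f D z \<Longrightarrow> has_qderiv g E z \<Longrightarrow> g z \<noteq> 0 \<Longrightarrow>
     has_qderiv (\<lambda>z. f z / g z) ((D * g z - f z * E) / (g z)\<^sup>2) z"
  unfolding has_qderiv_def
  by (auto intro!: derivative_eq_intros simp: field_simps power2_eq_square)

lemma has_qderiv_double: "has_qderiv f D (2 * z) \<Longrightarrow> has_qderiv (\<lambda>z. f (2 * z)) (2 * D) z"
  unfolding has_qderiv_def
  by (rule DERIV_cong[OF DERIV_chain2[of f _ "\<lambda>z. 2 * z" z 2]], assumption)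
    (auto intro!: derivative_eq_intros)

text \<open>The means of differentiating a functional identity: the rules supply a derivative for
  each side, and equality on the open half-plane identifies the two.\<close>

lemma has_qderiv_unique:
  assumes eq: "\<And>z. Im z > 0 \<Longrightarrow> f z = g z" and z: "Im z > 0"
    and f: "has_qderiv f D z" and g: "has_qderiv g E z"
  shows "D = E"
proof -
  have "(g has_field_derivative \<i> * pi * D) (at z)"
    by (rule has_field_derivative_transform_within_open[of f _ _ "{z. Im z > 0}"])
      (use assms in \<open>auto simp: has_qderiv_def open_halfspace_Im_gt\<close>)
  hence "\<i> * pi * D = \<i> * pi * E"
    using g DERIV_unique unfolding has_qderiv_def by blast
  thus ?thesis by simp
qed

lemmas has_qderiv_intros =
  has_qderiv_const has_qderiv_add has_qderiv_diff has_qderiv_mult has_qderiv_power has_qderiv_double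

lemma has_qderiv_theta_moment:
  "Im z > 0 \<Longrightarrow> a' = a + 2 \<Longrightarrow> has_qderiv (theta_moment b s a) (theta_moment b s a' z) z"
  unfolding has_qderiv_def using theta_moment_has_derivative by simp

text \<open>For even a this is D^(a/2) theta / theta. Dividing by the moment of order 0 gives the
  normalisation V 0 = 1 under which the cumulant formulas hold.\<close>

definition theta_ratio :: "bool \<Rightarrow> real \<Rightarrow> nat \<Rightarrow> complex \<Rightarrow> complex" where
  "theta_ratio b s a z = theta_moment b s a z / theta_moment b s 0 z"

lemma has_qderiv_theta_ratio:
  assumes "Im z > 0" "theta_moment b s 0 z \<noteq> 0" "a' = a + 2"
  shows "has_qderiv (theta_ratio b s a) (theta_ratio b s a' z - theta_ratio b s a z * theta_ratio b s 2 z) z"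
  unfolding theta_ratio_def[abs_def]
  by (rule has_qderiv_eq_rhs[OF has_qderiv_divide[OF has_qderiv_theta_moment[of _ a' a]
      has_qderiv_theta_moment[of _ 2 0]]])
    (use assms in \<open>auto simp: field_simps power2_eq_square\<close>)

abbreviation "dlog_theta2 \<equiv> theta_ratio False (1/2) 2"
abbreviation "dlog_theta3 \<equiv> theta_ratio False 0 2"
abbreviation "dlog_theta4 \<equiv> theta_ratio True 0 2"

lemma has_qderiv_theta:
  assumes "Im z > 0"
  shows "has_qderiv theta2 (theta2 z * dlog_theta2 z) z"
    "has_qderiv theta3 (theta3 z * dlog_theta3 z) z"
    "has_qderiv theta4 (theta4 z * dlog_theta4 z) z"
  using has_qderiv_theta_moment[OF assms, of 2 0] theta2_nonzero[OF assms]
    theta3_nonzero[OF assms] theta4_nonzero[OF assms]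
  by (auto simp: theta2_eq[abs_def] theta3_eq[abs_def] theta4_eq[abs_def] theta_ratio_def)

context
  fixes z :: complex
  assumes z: "Im z > 0"
begin

private lemma z2: "Im (2 * z) > 0"
  using z by simp

lemmas theta_nonzero = theta2_nonzero[OF z] theta3_nonzero[OF z] theta4_nonzero[OF z]
lemmas theta_nonzero_double = theta2_nonzero[OF z2] theta3_nonzero[OF z2] theta4_nonzero[OF z2]

text \<open>Logarithmic derivative of \<open>theta2_squared\<close>; the 2 from the square cancels
  against the chain rule factor of z -> 2 z.\<close>

lemma dlog_theta2_double: "dlog_theta2 z = dlog_theta2 (2 * z) + dlog_theta3 (2 * z)"
proof -
  have "of_nat 2 * theta2 z ^ (2 - 1) * (theta2 z * dlog_theta2 z) =
      (0 * theta2 (2 * z) + 2 * (2 * (theta2 (2 * z) * dlog_theta2 (2 * z)))) * theta3 (2 * z) +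
      2 * theta2 (2 * z) * (2 * (theta3 (2 * z) * dlog_theta3 (2 * z)))"
    by (rule has_qderiv_unique[OF _ z], erule theta2_squared) (intro has_qderiv_intros has_qderiv_theta z z2)+
  hence "theta2 z ^ 2 * dlog_theta2 z = 2 * theta2 (2 * z) * theta3 (2 * z) * (dlog_theta2 (2 * z) + dlog_theta3 (2 * z))"
    by simp algebra
  thus ?thesis using theta_nonzero_double by (simp add: theta2_squared[OF z])
qed

lemma dlog_theta3_plus_dlog_theta4: "dlog_theta3 z + dlog_theta4 z = 4 * dlog_theta4 (2 * z)"
proof -
  have "theta3 z * dlog_theta3 z * theta4 z + theta3 z * (theta4 z * dlog_theta4 z) =
      of_nat 2 * theta4 (2 * z) ^ (2 - 1) * (2 * (theta4 (2 * z) * dlog_theta4 (2 * z)))"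
    by (rule has_qderiv_unique[OF _ z], erule theta3_times_theta4) (intro has_qderiv_intros has_qderiv_theta z z2)+
  hence "(theta3 z * theta4 z) * (dlog_theta3 z + dlog_theta4 z) = theta4 (2 * z) ^ 2 * (4 * dlog_theta4 (2 * z))"
    by (simp add: power2_eq_square algebra_simps)
  thus ?thesis using theta_nonzero_double by (simp add: theta3_times_theta4[OF z])
qed

text \<open>Since \<open>theta3_squared\<close> has a sum on the right, its derivative keeps the
  squared thetas as weights.\<close>

lemma dlog_theta3_double:
  "theta3 z ^ 2 * dlog_theta3 z =
     2 * (theta3 (2 * z) ^ 2 * dlog_theta3 (2 * z) + theta2 (2 * z) ^ 2 * dlog_theta2 (2 * z))"
proof -
  have "of_nat 2 * theta3 z ^ (2 - 1) * (theta3 z * dlog_theta3 z) =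
      of_nat 2 * theta3 (2 * z) ^ (2 - 1) * (2 * (theta3 (2 * z) * dlog_theta3 (2 * z))) +
      of_nat 2 * theta2 (2 * z) ^ (2 - 1) * (2 * (theta2 (2 * z) * dlog_theta2 (2 * z)))"
    by (rule has_qderiv_unique[OF _ z], erule theta3_squared) (intro has_qderiv_intros has_qderiv_theta z z2)+
  thus ?thesis by simp algebra
qed

lemma dlog_theta4_double:
  "theta4 z ^ 2 * dlog_theta4 z =
     2 * (theta3 (2 * z) ^ 2 * dlog_theta3 (2 * z) - theta2 (2 * z) ^ 2 * dlog_theta2 (2 * z))"
proof -
  have "of_nat 2 * theta4 z ^ (2 - 1) * (theta4 z * dlog_theta4 z) =
      of_nat 2 * theta3 (2 * z) ^ (2 - 1) * (2 * (theta3 (2 * z) * dlog_theta3 (2 * z))) -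
      of_nat 2 * theta2 (2 * z) ^ (2 - 1) * (2 * (theta2 (2 * z) * dlog_theta2 (2 * z)))"
    by (rule has_qderiv_unique[OF _ z], erule theta4_squared) (intro has_qderiv_intros has_qderiv_theta z z2)+
  thus ?thesis by simp algebra
qed

lemma theta4_double_power4: "theta4 (2 * z) ^ 4 = theta3 z ^ 2 * theta4 z ^ 2"
  using theta3_times_theta4[OF z] by (metis power_mult_distrib power_mult mult_2_right numeral_Bit0)

text \<open>By the Landen relations \<open>theta3 z ^ 2\<close> times the difference at z is
  \<open>theta4 z ^ 2\<close> times the difference at 2 z. Dividing by theta3^2 theta4^4 leaves
  theta3^2 theta4^2 under the difference at 2 z, and this is
  \<open>theta4 (2 * z) ^ 4\<close>.\<close>

lemma dlog_theta2_minus_dlog_theta3_double: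
  "(dlog_theta2 z - dlog_theta3 z) / theta4 z ^ 4 =
     (dlog_theta2 (2 * z) - dlog_theta3 (2 * z)) / theta4 (2 * z) ^ 4"
proof -
  have "theta3 z ^ 2 * (dlog_theta2 z - dlog_theta3 z) = theta4 z ^ 2 * (dlog_theta2 (2 * z) - dlog_theta3 (2 * z))"
    unfolding right_diff_distrib[of "theta3 z ^ 2"] dlog_theta3_double
    unfolding theta3_squared[OF z] dlog_theta2_double theta4_squared[OF z] by (simp add: algebra_simps)
  moreover have "theta4 z ^ 4 = theta4 z ^ 2 * theta4 z ^ 2" by (simp flip: power_add)
  ultimately show ?thesis unfolding theta4_double_power4 using theta_nonzero
    by (simp add: frac_eq_eq) algebra
qed

end

text \<open>The factor q^(1/4) cancels in the quotient; 1/4 is the leading exponent (1/2)^2.\<close>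

lemma dlog_theta2_tendsto: "(dlog_theta2 \<longlongrightarrow> 1/4) at_cusp"
proof -
  let ?e = "\<lambda>z. exp (- (\<i> * pi * z / 4))"
  have "((\<lambda>z. (?e z * theta_moment False (1/2) 2 z) / (?e z * theta_moment False (1/2) 0 z)) \<longlongrightarrow>
     (\<Sum>m\<in>{-1, 0::int}. of_real ((of_int m + 1/2) ^ 2)) / (\<Sum>m\<in>{-1, 0::int}. of_real ((of_int m + 1/2) ^ 0))) at_cusp"
    by (intro tendsto_divide theta_moment_half_tendsto) simp
  thus ?thesis by (simp add: theta_ratio_def[abs_def] power2_eq_square)
qed

lemma theta_ratio_decay:
  assumes "a > 0"
  shows "((\<lambda>z. of_real (Im z) ^ k * theta_ratio b 0 a z) \<longlongrightarrow> 0) at_cusp"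
  using tendsto_divide[OF theta_moment_decay[OF assms, of k b] theta_moment_tendsto_1[of b]]
  by (simp add: theta_ratio_def)

lemma dlog_theta2_minus_dlog_theta3:
  assumes "Im z > 0"
  shows "dlog_theta2 z - dlog_theta3 z = theta4 z ^ 4 / 4"
proof -
  have lim: "((\<lambda>z. (dlog_theta2 z - dlog_theta3 z) / theta4 z ^ 4) \<longlongrightarrow> (1/4 - 0) / 1 ^ 4) at_cusp"
  proof (intro tendsto_divide tendsto_diff tendsto_power)
    show "(dlog_theta3 \<longlongrightarrow> 0) at_cusp" using theta_ratio_decay[of 2 0 False] by simp
    show "(theta4 \<longlongrightarrow> 1) at_cusp" using theta_moment_tendsto_1[of True] by (simp add: theta4_eq[abs_def])
  qed (use dlog_theta2_tendsto in simp_all)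
  have "(dlog_theta2 z - dlog_theta3 z) / theta4 z ^ 4 = (1/4 - 0) / 1 ^ 4"
    by (rule doubling_invariant_eq_limit[OF dlog_theta2_minus_dlog_theta3_double lim assms])
  thus ?thesis using theta4_nonzero[OF assms] by (simp add: field_simps)
qed

text \<open>Both sides tend to 0 at the cusp, so instead of taking a second limit the preceding
  identity is used at 2 z and carried to z by Landen's relations: there \<open>theta2 z ^ 4\<close>
  is 4 A B.\<close>

lemma dlog_theta3_minus_dlog_theta4:
  assumes z: "Im z > 0"
  shows "dlog_theta3 z - dlog_theta4 z = theta2 z ^ 4 / 4"
proof -
  have z2: "Im (2 * z) > 0" using z by simp
  define A B a b where "A = theta2 (2 * z) ^ 2" and "B = theta3 (2 * z) ^ 2"
    and "a = dlog_theta2 (2 * z)" and "b = dlog_theta3 (2 * z)"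
  have t3: "theta3 z ^ 2 = B + A" and t4: "theta4 z ^ 2 = B - A"
    using theta3_squared[OF z] theta4_squared[OF z] by (simp_all add: A_def B_def)
  have ab: "a - b = (B + A) * (B - A) / 4"
    using dlog_theta2_minus_dlog_theta3[OF z2] theta4_double_power4[OF z]
    by (simp add: t3 t4 a_def b_def)
  have t2: "theta2 z ^ 4 = 4 * A * B"
  proof -
    have "theta2 z ^ 4 = (theta2 z ^ 2) ^ 2" by (simp flip: power_mult)
    thus ?thesis unfolding theta2_squared[OF z] by (simp add: A_def B_def power_mult_distrib)
  qed
  have nz: "B + A \<noteq> 0" "B - A \<noteq> 0"
    using theta3_nonzero[OF z] theta4_nonzero[OF z] t3 t4 by (metis zero_eq_power2)+
  have "(B + A) * dlog_theta3 z = 2 * (B * b + A * a)" "(B - A) * dlog_theta4 z = 2 * (B * b - A * a)"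
    using dlog_theta3_double[OF z] dlog_theta4_double[OF z] unfolding t3 t4
    by (simp_all add: A_def B_def a_def b_def)
  hence "(B + A) * (B - A) * (dlog_theta3 z - dlog_theta4 z) =
      (B - A) * (2 * (B * b + A * a)) - (B + A) * (2 * (B * b - A * a))"
    by algebra
  also have "\<dots> = 4 * A * B * (a - b)" by (simp add: algebra_simps)
  also have "\<dots> = (B + A) * (B - A) * (theta2 z ^ 4 / 4)" unfolding ab t2 by simp
  finally show ?thesis using nz by simp
qed

text \<open>Written at 2 z by Landen's relations this is (B + A)^2 = 4 A B + (B - A)^2, with A and B
  the squares of \<open>theta2\<close> and \<open>theta3\<close> there.\<close>

lemma theta_jacobi_identity:
  assumes z: "Im z > 0"
  shows "theta3 z ^ 4 = theta2 z ^ 4 + theta4 z ^ 4"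
proof -
  have "theta2 z ^ 4 = (theta2 z ^ 2) ^ 2" "theta3 z ^ 4 = (theta3 z ^ 2) ^ 2" "theta4 z ^ 4 = (theta4 z ^ 2) ^ 2"
    by (simp_all flip: power_mult)
  thus ?thesis unfolding theta2_squared[OF z] theta3_squared[OF z] theta4_squared[OF z]
    by (simp add: power2_eq_square algebra_simps)
qed

lemma dlog_theta2_minus_dlog_theta4:
  assumes "Im z > 0"
  shows "dlog_theta2 z - dlog_theta4 z = theta3 z ^ 4 / 4"
  using dlog_theta2_minus_dlog_theta3[OF assms] dlog_theta3_minus_dlog_theta4[OF assms]
  unfolding theta_jacobi_identity[OF assms] by (simp add: field_simps)

subsection \<open>The Halphen system\<close>

abbreviation "d2log_theta2 z \<equiv> theta_ratio False (1/2) 4 z - dlog_theta2 z ^ 2"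
abbreviation "d2log_theta3 z \<equiv> theta_ratio False 0 4 z - dlog_theta3 z ^ 2"
abbreviation "d2log_theta4 z \<equiv> theta_ratio True 0 4 z - dlog_theta4 z ^ 2"

lemma has_qderiv_dlog_theta:
  assumes "Im z > 0"
  shows "has_qderiv dlog_theta2 (d2log_theta2 z) z"
    "has_qderiv dlog_theta3 (d2log_theta3 z) z"
    "has_qderiv dlog_theta4 (d2log_theta4 z) z"
  using has_qderiv_theta_ratio[OF assms, of False "1/2" 4 2] has_qderiv_theta_ratio[OF assms, of False 0 4 2]
    has_qderiv_theta_ratio[OF assms, of True 0 4 2] theta2_nonzero[OF assms] theta3_nonzero[OF assms]
    theta4_nonzero[OF assms]
  by (auto simp: theta2_eq theta3_eq theta4_eq power2_eq_square)

lemma d2log_theta2_double: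
  assumes z: "Im z > 0"
  shows "d2log_theta2 z = 2 * d2log_theta2 (2 * z) + 2 * d2log_theta3 (2 * z)"
  by (rule has_qderiv_unique[OF _ z], erule dlog_theta2_double)
    (intro has_qderiv_intros has_qderiv_dlog_theta; use z in simp)+

text \<open>Four times the difference of the logarithmic derivatives is \<open>theta4 z ^ 4\<close>,
  whose own logarithmic derivative is \<open>4 * dlog_theta4 z\<close>. The result is the difference
  of two equations of the Halphen system.\<close>

lemma d2log_theta2_minus_d2log_theta3:
  assumes z: "Im z > 0"
  shows "d2log_theta2 z - d2log_theta3 z = 4 * dlog_theta4 z * (dlog_theta2 z - dlog_theta3 z)"
proof -
  have "4 * (d2log_theta2 z - d2log_theta3 z) = of_nat 4 * theta4 z ^ (4 - 1) * (theta4 z * dlog_theta4 z)"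
  proof (rule has_qderiv_unique[OF _ z])
    show "4 * (dlog_theta2 w - dlog_theta3 w) = theta4 w ^ 4" if "Im w > 0" for w
      unfolding dlog_theta2_minus_dlog_theta3[OF that] by simp
    show "has_qderiv (\<lambda>w. 4 * (dlog_theta2 w - dlog_theta3 w)) (4 * (d2log_theta2 z - d2log_theta3 z)) z"
      by (rule has_qderiv_eq_rhs[OF has_qderiv_mult[OF has_qderiv_const
          has_qderiv_diff[OF has_qderiv_dlog_theta(1)[OF z] has_qderiv_dlog_theta(2)[OF z]]]]) simp
  qed (intro has_qderiv_intros has_qderiv_theta z)+
  also have "\<dots> = theta4 z ^ 4 * (4 * dlog_theta4 z)" by (simp add: power_numeral_reduce)
  also have "theta4 z ^ 4 = 4 * (dlog_theta2 z - dlog_theta3 z)"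
    unfolding dlog_theta2_minus_dlog_theta3[OF z] by simp
  finally show ?thesis by algebra
qed

lemma d2log_theta3_minus_d2log_theta4:
  assumes z: "Im z > 0"
  shows "d2log_theta3 z - d2log_theta4 z = 4 * dlog_theta2 z * (dlog_theta3 z - dlog_theta4 z)"
proof -
  have "4 * (d2log_theta3 z - d2log_theta4 z) = of_nat 4 * theta2 z ^ (4 - 1) * (theta2 z * dlog_theta2 z)"
  proof (rule has_qderiv_unique[OF _ z])
    show "4 * (dlog_theta3 w - dlog_theta4 w) = theta2 w ^ 4" if "Im w > 0" for w
      unfolding dlog_theta3_minus_dlog_theta4[OF that] by simp
    show "has_qderiv (\<lambda>w. 4 * (dlog_theta3 w - dlog_theta4 w)) (4 * (d2log_theta3 z - d2log_theta4 z)) z"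
      by (rule has_qderiv_eq_rhs[OF has_qderiv_mult[OF has_qderiv_const
          has_qderiv_diff[OF has_qderiv_dlog_theta(2)[OF z] has_qderiv_dlog_theta(3)[OF z]]]]) simp
  qed (intro has_qderiv_intros has_qderiv_theta z)+
  also have "\<dots> = theta2 z ^ 4 * (4 * dlog_theta2 z)" by (simp add: power_numeral_reduce)
  also have "theta2 z ^ 4 = 4 * (dlog_theta3 z - dlog_theta4 z)"
    unfolding dlog_theta3_minus_dlog_theta4[OF z] by simp
  finally show ?thesis by algebra
qed

text \<open>The two preceding lemmas say that the defects of the three equations of the Halphen system coincide.
  This common defect is multiplied by 4 when passing from \<open>2 z\<close> to \<open>z\<close> but decays exponentially, so it vanishes.\<close>

definition halphen_defect :: "complex \<Rightarrow> complex" where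
  "halphen_defect z = d2log_theta3 z -
     2 * (dlog_theta3 z * dlog_theta2 z + dlog_theta3 z * dlog_theta4 z - dlog_theta2 z * dlog_theta4 z)"

lemma halphen_defect_double:
  assumes z: "Im z > 0"
  shows "halphen_defect z = 4 * halphen_defect (2 * z)"
proof -
  have z2: "Im (2 * z) > 0" using z by simp
  define a b c A B C va vb Va Vb where defs: "a = dlog_theta2 z" "b = dlog_theta3 z" "c = dlog_theta4 z"
    "A = dlog_theta2 (2 * z)" "B = dlog_theta3 (2 * z)" "C = dlog_theta4 (2 * z)"
    "va = d2log_theta2 z" "vb = d2log_theta3 z" "Va = d2log_theta2 (2 * z)" "Vb = d2log_theta3 (2 * z)"
  have 1: "a = A + B" "b + c = 4 * C" "va = 2 * Va + 2 * Vb"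
      "va - vb = 4 * c * (a - b)" "Va - Vb = 4 * C * (A - B)"
    unfolding defs using dlog_theta2_double[OF z] dlog_theta3_plus_dlog_theta4[OF z] d2log_theta2_double[OF z]
      d2log_theta2_minus_d2log_theta3[OF z] d2log_theta2_minus_d2log_theta3[OF z2] by auto
  \<comment> \<open>Rewritten as \<open>va - 2 * a * (b + c) + 2 * (b * c)\<close>, the defect is
    symmetric in \<open>b\<close> and \<open>c\<close>. Their sum is known at 2 z; their product
    follows once \<open>(b - c) ^ 2\<close> is known there.\<close>
  have "b - c = theta2 (2 * z) ^ 2 * theta3 (2 * z) ^ 2"
  proof -
    have "b - c = (theta2 z ^ 2) ^ 2 / 4"
      unfolding defs dlog_theta3_minus_dlog_theta4[OF z] by (simp flip: power_mult)
    thus ?thesis unfolding theta2_squared[OF z] by (simp add: power_mult_distrib)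
  qed
  hence "(b - c) ^ 2 = theta2 (2 * z) ^ 4 * theta3 (2 * z) ^ 4"
    by (simp add: power_mult_distrib flip: power_mult)
  moreover have "theta2 (2 * z) ^ 4 = 4 * (B - C)" "theta3 (2 * z) ^ 4 = 4 * (A - C)"
    unfolding defs dlog_theta3_minus_dlog_theta4[OF z2] dlog_theta2_minus_dlog_theta4[OF z2] by simp_all
  ultimately have bc: "(b - c) ^ 2 = 16 * (B - C) * (A - C)" by algebra
  have 2: "b * c = 4 * C\<^sup>2 - 4 * (B - C) * (A - C)"
  proof -
    have "4 * (b * c) = (b + c) ^ 2 - (b - c) ^ 2" by (simp add: power2_eq_square algebra_simps)
    also have "\<dots> = 4 * (4 * C\<^sup>2 - 4 * (B - C) * (A - C))"
      unfolding bc 1(2) by (simp add: power2_eq_square algebra_simps)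
    finally show ?thesis by algebra
  qed
  have "vb - 2 * (b * a + b * c - a * c) = va - 2 * a * (b + c) + 2 * (b * c)"
    using 1(4) by (simp add: algebra_simps)
  also have "\<dots> = 2 * (Va + Vb) - 8 * (A + B) * C + 2 * (4 * C\<^sup>2 - 4 * (B - C) * (A - C))"
    unfolding 1(1,2,3) 2 by (simp add: algebra_simps)
  also have "\<dots> = 4 * (Vb - 2 * (B * A + B * C - A * C))"
    using 1(5) by algebra
  finally show ?thesis unfolding halphen_defect_def defs .
qed

lemma halphen_defect_eq_0:
  assumes z: "Im z > 0"
  shows "halphen_defect z = 0"
proof -
  let ?f = "\<lambda>z. of_real (Im z) ^ 2 * halphen_defect z"
  have "?f z = 0"
  proof (rule doubling_invariant_eq_limit[of ?f, OF _ _ z])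
    show "?f w = ?f (2 * w)" if "Im w > 0" for w
      using halphen_defect_double[OF that] by (simp add: power2_eq_square)
    let ?y = "\<lambda>z. of_real (Im z) ^ 2 :: complex"
    have 0: "((\<lambda>z. theta_ratio b 0 2 z) \<longlongrightarrow> 0) at_cusp" for b
      using theta_ratio_decay[of 2 0 b] by simp
    \<comment> \<open>Only \<open>dlog_theta2\<close> fails to decay. In the defect of the
      \<open>theta3\<close> equation every monomial has a decaying factor, and the weight is
      attached to that factor.\<close>
    have "((\<lambda>z. ?y z * theta_ratio False 0 4 z - ?y z * dlog_theta3 z * dlog_theta3 z -
        2 * (?y z * dlog_theta3 z * dlog_theta2 z + ?y z * dlog_theta3 z * dlog_theta4 z -
          dlog_theta2 z * (?y z * dlog_theta4 z))) \<longlongrightarrow>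
        0 - 0 * 0 - 2 * (0 * (1/4) + 0 * 0 - (1/4) * 0)) at_cusp"
      by (intro tendsto_diff tendsto_add tendsto_mult theta_ratio_decay 0 dlog_theta2_tendsto tendsto_const) simp_all
    also have "(\<lambda>z. ?y z * theta_ratio False 0 4 z - ?y z * dlog_theta3 z * dlog_theta3 z -
        2 * (?y z * dlog_theta3 z * dlog_theta2 z + ?y z * dlog_theta3 z * dlog_theta4 z -
          dlog_theta2 z * (?y z * dlog_theta4 z))) = ?f"
      unfolding halphen_defect_def by (rule ext) algebra
    finally show "(?f \<longlongrightarrow> 0) at_cusp" by simp
  qed
  thus ?thesis using z by simp
qed

lemma halphen_system:
  assumes z: "Im z > 0"
  shows "d2log_theta2 z = 2 * (dlog_theta2 z * dlog_theta3 z + dlog_theta2 z * dlog_theta4 z - dlog_theta3 z * dlog_theta4 z)"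
    and "d2log_theta3 z = 2 * (dlog_theta3 z * dlog_theta2 z + dlog_theta3 z * dlog_theta4 z - dlog_theta2 z * dlog_theta4 z)"
    and "d2log_theta4 z = 2 * (dlog_theta4 z * dlog_theta2 z + dlog_theta4 z * dlog_theta3 z - dlog_theta2 z * dlog_theta3 z)"
  using halphen_defect_eq_0[OF z] d2log_theta2_minus_d2log_theta3[OF z] d2log_theta3_minus_d2log_theta4[OF z]
  unfolding halphen_defect_def by algebra+

text \<open>Stated for an abstract triple, since it is applied with each of the three thetas in
  front. The first equation and its derivative eliminate the moments of order 4 and 6; the
  polynomials left over in u1, u2, u3 factor into differences, which are known to be fourth powers
  of thetas up to constants.\<close>

lemma halphen_moments:
  assumes ne: "\<forall>z. Im z > 0 \<longrightarrow> theta_moment b1 s1 0 z \<noteq> 0" "\<forall>z. Im z > 0 \<longrightarrow> theta_moment b2 s2 0 z \<noteq> 0"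
      "\<forall>z. Im z > 0 \<longrightarrow> theta_moment b3 s3 0 z \<noteq> 0"
    and u_def: "u1 = theta_ratio b1 s1 2" "u2 = theta_ratio b2 s2 2" "u3 = theta_ratio b3 s3 2"
    and h1: "\<forall>z. Im z > 0 \<longrightarrow> theta_ratio b1 s1 4 z - u1 z ^ 2 = 2 * (u1 z * u2 z + u1 z * u3 z - u2 z * u3 z)"
    and h2: "\<forall>z. Im z > 0 \<longrightarrow> theta_ratio b2 s2 4 z - u2 z ^ 2 = 2 * (u2 z * u1 z + u2 z * u3 z - u1 z * u3 z)"
    and h3: "\<forall>z. Im z > 0 \<longrightarrow> theta_ratio b3 s3 4 z - u3 z ^ 2 = 2 * (u3 z * u1 z + u3 z * u2 z - u1 z * u2 z)"
    and z: "Im z > 0"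
  shows "theta_ratio b1 s1 4 z - 3 * u1 z ^ 2 = - 2 * (u1 z - u2 z) * (u1 z - u3 z)" (is ?th1)
    and "theta_ratio b1 s1 6 z - 15 * u1 z * theta_ratio b1 s1 4 z + 30 * u1 z ^ 3 =
      8 * (u1 z - u2 z) * (u1 z - u3 z) * (2 * u1 z - u2 z - u3 z)" (is ?th2)
proof -
  note ne = ne[rule_format] and h1 = h1[rule_format] and h2 = h2[rule_format] and h3 = h3[rule_format]
  show ?th1 using h1[OF z] by algebra
  have D: "has_qderiv u1 (theta_ratio b1 s1 4 z - u1 z * u1 z) z"
    "has_qderiv u2 (theta_ratio b2 s2 4 z - u2 z * u2 z) z"
    "has_qderiv u3 (theta_ratio b3 s3 4 z - u3 z * u3 z) z"
    unfolding u_def by (intro has_qderiv_theta_ratio z ne; simp)+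
  define v1 v2 v3 where "v1 = theta_ratio b1 s1 4 z - u1 z * u1 z" and
    "v2 = theta_ratio b2 s2 4 z - u2 z * u2 z" and "v3 = theta_ratio b3 s3 4 z - u3 z * u3 z"
  note D = D[folded v1_def v2_def v3_def]
  have D4: "has_qderiv (theta_ratio b1 s1 4) (theta_ratio b1 s1 6 z - theta_ratio b1 s1 4 z * u1 z) z"
    unfolding u_def by (intro has_qderiv_theta_ratio z ne) simp
  have "theta_ratio b1 s1 6 z - theta_ratio b1 s1 4 z * u1 z - (v1 * u1 z + u1 z * v1) =
     (0 * (u1 z * u2 z + u1 z * u3 z - u2 z * u3 z) +
      2 * ((v1 * u2 z + u1 z * v2) + (v1 * u3 z + u1 z * v3) - (v2 * u3 z + u2 z * v3)))"
  proof (rule has_qderiv_unique[OF _ z])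
    show "theta_ratio b1 s1 4 z - u1 z * u1 z = 2 * (u1 z * u2 z + u1 z * u3 z - u2 z * u3 z)" if "Im z > 0" for z
      using h1[OF that] by (simp add: power2_eq_square)
  qed (intro has_qderiv_intros D D4)+
  moreover have "v1 = 2 * (u1 z * u2 z + u1 z * u3 z - u2 z * u3 z)"
    "v2 = 2 * (u2 z * u1 z + u2 z * u3 z - u1 z * u3 z)" "v3 = 2 * (u3 z * u1 z + u3 z * u2 z - u1 z * u2 z)"
    unfolding v1_def v2_def v3_def using h1[OF z] h2[OF z] h3[OF z] by (simp_all add: power2_eq_square)
  moreover have "theta_ratio b1 s1 4 z = v1 + u1 z * u1 z" by (simp add: v1_def)
  ultimately show ?th2 by algebra
qed

lemma theta_ratio_identities:
  assumes z: "Im z > 0"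
  shows "theta_ratio False (1/2) 4 z - 3 * dlog_theta2 z ^ 2 = - (theta3 z ^ 4 * theta4 z ^ 4) / 8"
    and "theta_ratio False 0 4 z - 3 * dlog_theta3 z ^ 2 = theta2 z ^ 4 * theta4 z ^ 4 / 8"
    and "theta_ratio True 0 4 z - 3 * dlog_theta4 z ^ 2 = - (theta2 z ^ 4 * theta3 z ^ 4) / 8"
    and "theta_ratio False (1/2) 6 z - 15 * dlog_theta2 z * theta_ratio False (1/2) 4 z + 30 * dlog_theta2 z ^ 3
       = theta3 z ^ 4 * theta4 z ^ 4 * (theta3 z ^ 4 + theta4 z ^ 4) / 8"
    and "theta_ratio False 0 6 z - 15 * dlog_theta3 z * theta_ratio False 0 4 z + 30 * dlog_theta3 z ^ 3
       = theta2 z ^ 4 * theta4 z ^ 4 * (theta4 z ^ 4 - theta2 z ^ 4) / 8"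
    and "theta_ratio True 0 6 z - 15 * dlog_theta4 z * theta_ratio True 0 4 z + 30 * dlog_theta4 z ^ 3
       = - (theta2 z ^ 4 * theta3 z ^ 4 * (theta2 z ^ 4 + theta3 z ^ 4)) / 8"
proof -
  let ?u2 = dlog_theta2 and ?u3 = dlog_theta3 and ?u4 = dlog_theta4
  have ne: "\<forall>z. Im z > 0 \<longrightarrow> theta_moment False (1/2) 0 z \<noteq> 0" "\<forall>z. Im z > 0 \<longrightarrow> theta_moment False 0 0 z \<noteq> 0"
    "\<forall>z. Im z > 0 \<longrightarrow> theta_moment True 0 0 z \<noteq> 0"
    using theta2_nonzero theta3_nonzero theta4_nonzero by (simp_all add: theta2_eq theta3_eq theta4_eq)
  \<comment> \<open>Each difference is a quarter of a fourth power up to sign, so the factors 2 and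
    8 of \<open>halphen_moments\<close> become 2/16 and 8/64, both 1/8.\<close>
  have t: "theta4 z ^ 4 = 4 * (?u2 z - ?u3 z)" "theta2 z ^ 4 = 4 * (?u3 z - ?u4 z)" "theta3 z ^ 4 = 4 * (?u2 z - ?u4 z)"
    unfolding dlog_theta2_minus_dlog_theta3[OF z] dlog_theta3_minus_dlog_theta4[OF z] dlog_theta2_minus_dlog_theta4[OF z]
    by simp_all
  \<comment> \<open>Each equation is listed with both orders of its other two functions, to fit the
    three instantiations below.\<close>
  have h2: "\<forall>z. Im z > 0 \<longrightarrow> d2log_theta2 z = 2 * (?u2 z * ?u3 z + ?u2 z * ?u4 z - ?u3 z * ?u4 z)"
       "\<forall>z. Im z > 0 \<longrightarrow> d2log_theta2 z = 2 * (?u2 z * ?u4 z + ?u2 z * ?u3 z - ?u4 z * ?u3 z)"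
    and h3: "\<forall>z. Im z > 0 \<longrightarrow> d2log_theta3 z = 2 * (?u3 z * ?u2 z + ?u3 z * ?u4 z - ?u2 z * ?u4 z)"
       "\<forall>z. Im z > 0 \<longrightarrow> d2log_theta3 z = 2 * (?u3 z * ?u4 z + ?u3 z * ?u2 z - ?u4 z * ?u2 z)"
    and h4: "\<forall>z. Im z > 0 \<longrightarrow> d2log_theta4 z = 2 * (?u4 z * ?u2 z + ?u4 z * ?u3 z - ?u2 z * ?u3 z)"
       "\<forall>z. Im z > 0 \<longrightarrow> d2log_theta4 z = 2 * (?u4 z * ?u3 z + ?u4 z * ?u2 z - ?u3 z * ?u2 z)"
    using halphen_system by (simp_all add: algebra_simps)
  note m2 = halphen_moments[OF ne refl refl refl h2(1) h3(1) h4(1) z]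
  note m3 = halphen_moments[OF ne(2,1,3) refl refl refl h3(1) h2(1) h4(2) z]
  note m4 = halphen_moments[OF ne(3,1,2) refl refl refl h4(1) h2(2) h3(2) z]
  show "theta_ratio False (1/2) 4 z - 3 * dlog_theta2 z ^ 2 = - (theta3 z ^ 4 * theta4 z ^ 4) / 8"
    "theta_ratio False (1/2) 6 z - 15 * dlog_theta2 z * theta_ratio False (1/2) 4 z + 30 * dlog_theta2 z ^ 3
       = theta3 z ^ 4 * theta4 z ^ 4 * (theta3 z ^ 4 + theta4 z ^ 4) / 8"
    unfolding m2 t by (simp_all add: algebra_simps)
  show "theta_ratio False 0 4 z - 3 * dlog_theta3 z ^ 2 = theta2 z ^ 4 * theta4 z ^ 4 / 8"
    "theta_ratio False 0 6 z - 15 * dlog_theta3 z * theta_ratio False 0 4 z + 30 * dlog_theta3 z ^ 3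
       = theta2 z ^ 4 * theta4 z ^ 4 * (theta4 z ^ 4 - theta2 z ^ 4) / 8"
    unfolding m3 t by (simp_all add: algebra_simps)
  show "theta_ratio True 0 4 z - 3 * dlog_theta4 z ^ 2 = - (theta2 z ^ 4 * theta3 z ^ 4) / 8"
    "theta_ratio True 0 6 z - 15 * dlog_theta4 z * theta_ratio True 0 4 z + 30 * dlog_theta4 z ^ 3
       = - (theta2 z ^ 4 * theta3 z ^ 4 * (theta2 z ^ 4 + theta3 z ^ 4)) / 8"
    unfolding m4 t by (simp_all add: algebra_simps)
qed

subsection \<open>The Witt lattice\<close>

lemma has_sum_prod_PiE:
  fixes f :: "'a \<Rightarrow> int \<Rightarrow> complex"
  assumes fin: "finite A" and f: "\<And>i. i \<in> A \<Longrightarrow> (\<lambda>m. norm (f i m)) summable_on UNIV"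
  shows "((\<lambda>g. \<Prod>i\<in>A. f i (g i)) has_sum (\<Prod>i\<in>A. infsum (f i) UNIV)) (PiE A (\<lambda>_. UNIV))"
proof -
  have "(\<lambda>g. norm (\<Prod>i\<in>A. f i (g i))) summable_on (PiE A (\<lambda>_. UNIV))"
    unfolding abs_summable_equivalent
    by (rule abs_summable_on_prod_PiE[OF fin]) (use f in \<open>auto simp flip: abs_summable_equivalent\<close>)
  hence "(\<lambda>g. \<Prod>i\<in>A. f i (g i)) summable_on (PiE A (\<lambda>_. UNIV))"
    by (rule abs_summable_summable)
  moreover have "(\<Sum>\<^sub>\<infinity>g\<in>PiE A (\<lambda>_. UNIV). \<Prod>i\<in>A. f i (g i)) = (\<Prod>i\<in>A. infsum (f i) UNIV)"
    by (rule infsum_prod_PiE_abs[OF fin f])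
  ultimately show ?thesis by (metis has_sum_infsum)
qed

text \<open>Integer coordinates of the lattice D_n. The functions are extensional so that sums over
  them live on \<open>PiE\<close>, where they factor.\<close>

definition even_vectors :: "nat \<Rightarrow> (nat \<Rightarrow> int) set" where
  "even_vectors n = {m \<in> PiE {..<n} (\<lambda>_. UNIV). even (\<Sum>i<n. m i)}"

definition shifted_vector :: "nat \<Rightarrow> real \<Rightarrow> (nat \<Rightarrow> int) \<Rightarrow> nat \<Rightarrow> real" where
  "shifted_vector n s m = (\<lambda>i. if i < n then of_int (m i) + s else 0)"

lemma inj_on_shifted_vector: "inj_on (shifted_vector n s) (even_vectors n)"
proof (rule inj_onI)
  fix m k assume *: "m \<in> even_vectors n" "k \<in> even_vectors n" "shifted_vector n s m = shifted_vector n s k"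
  show "m = k"
  proof
    fix i
    show "m i = k i"
      using fun_cong[OF *(3), of i] *(1,2)
      by (cases "i < n") (auto simp: shifted_vector_def even_vectors_def PiE_def extensional_def)
  qed
qed

text \<open>For s = 1/2 the shift adds n/2 to the coordinate sum, and this is even because 4 divides
  n.\<close>

lemma shifted_vector_in_witt_lattice:
  assumes n: "4 dvd n" and s: "s = 0 \<or> s = 1/2" and m: "m \<in> even_vectors n"
  shows "shifted_vector n s m \<in> witt_lattice n"
proof -
  obtain t where t: "n = 4 * t" using n by (elim dvdE)
  obtain k where k: "(\<Sum>i<n. m i) = 2 * k" using m by (auto simp: even_vectors_def elim: evenE)
  have "(\<Sum>i<n. shifted_vector n s m i) = (\<Sum>i<n. of_int (m i) + s)"
    by (intro sum.cong) (auto simp: shifted_vector_def)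
  also have "\<dots> = of_int (\<Sum>i<n. m i) + 4 * t * s" by (simp add: sum.distrib t)
  also have "\<dots> = 2 * of_int (if s = 0 then k else k + t)" using s by (auto simp: k)
  finally have 1: "\<exists>k::int. (\<Sum>i<n. shifted_vector n s m i) = 2 * of_int k" by blast
  have 2: "2 * (of_int (m i) + s) \<in> \<int>" for i
  proof -
    have "2 * (of_int (m i) + s) = of_int (if s = 0 then 2 * m i else 2 * m i + 1)" using s by auto
    thus ?thesis by (metis Ints_of_int)
  qed
  show ?thesis unfolding witt_lattice_def using 1 2
    by (auto simp: shifted_vector_def)
qed

lemma witt_lattice_cases:
  assumes n: "n > 0" "4 dvd n" and x: "x \<in> witt_lattice n"
  shows "\<exists>s\<in>{0, 1/2}. x \<in> shifted_vector n s ` even_vectors n"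
proof -
  obtain t where t: "n = 4 * t" using n by (elim dvdE)
  obtain k where k: "2 * x 0 = of_int k" using x n by (auto simp: witt_lattice_def elim!: Ints_cases)
  \<comment> \<open>The parity of 2 x_0 selects the coset; as all x_i - x_0 are integers, the same
    \<open>s\<close> serves every coordinate.\<close>
  define s where "s = (if even k then 0 else 1/2 :: real)"
  have "\<exists>l. x 0 = of_int l + s"
  proof (cases "even k")
    case True
    then obtain l where "k = 2 * l" by (elim evenE)
    thus ?thesis using k True by (intro exI[of _ l]) (simp add: s_def)
  next
    case False
    then obtain l where "k = 2 * l + 1" by (elim oddE)
    thus ?thesis using k False by (intro exI[of _ l]) (simp add: s_def)
  qed
  then obtain l where l: "x 0 = of_int l + s" by blast
  have "\<forall>i. \<exists>m. i < n \<longrightarrow> x i = of_int m + s"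
  proof
    fix i
    show "\<exists>m. i < n \<longrightarrow> x i = of_int m + s"
    proof (cases "i < n")
      case True
      then have "x i - x 0 \<in> \<int>" using x by (simp add: witt_lattice_def)
      then obtain d where "x i - x 0 = of_int d" by (elim Ints_cases)
      thus ?thesis using l by (intro exI[of _ "l + d"]) simp
    qed simp
  qed
  then obtain m where m: "\<And>i. i < n \<Longrightarrow> x i = of_int (m i) + s" by metis
  define m' where "m' = restrict m {..<n}"
  have x_eq: "x = shifted_vector n s m'"
    using x m by (auto simp: fun_eq_iff shifted_vector_def m'_def witt_lattice_def)
  obtain j where "(\<Sum>i<n. x i) = 2 * of_int j" using x by (auto simp: witt_lattice_def)
  moreover have "(\<Sum>i<n. x i) = of_int (\<Sum>i<n. m' i) + 4 * t * s"
    by (simp add: x_eq shifted_vector_def sum.distrib t)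
  ultimately have "of_int (\<Sum>i<n. m' i) = (of_int (2 * (j - (if even k then 0 else int t))) :: real)"
    by (simp add: s_def split: if_splits)
  hence "even (\<Sum>i<n. m' i)" unfolding of_int_eq_iff by simp
  hence "m' \<in> even_vectors n" by (auto simp: even_vectors_def m'_def)
  thus ?thesis using x_eq by (intro bexI[of _ s]) (auto simp: s_def)
qed

lemma witt_lattice_eq:
  assumes "n > 0" "4 dvd n"
  shows "witt_lattice n = shifted_vector n 0 ` even_vectors n \<union> shifted_vector n (1/2) ` even_vectors n"
  using witt_lattice_cases[OF assms] shifted_vector_in_witt_lattice[OF assms(2)] by blast

lemma shifted_vector_disjoint:
  assumes "n > 0"
  shows "shifted_vector n 0 ` A \<inter> shifted_vector n (1/2) ` B = {}"
proof (rule ccontr)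
  assume "\<not> ?thesis"
  then obtain m k where "shifted_vector n 0 m 0 = shifted_vector n (1/2) k 0" by (auto simp: image_iff) metis
  hence "real_of_int (2 * m 0) = of_int (2 * k 0 + 1)" using assms by (simp add: shifted_vector_def)
  hence "2 * m 0 = 2 * k 0 + 1" unfolding of_int_eq_iff .
  thus False by presburger
qed

definition lattice_monomial :: "nat \<Rightarrow> (nat \<Rightarrow> nat) \<Rightarrow> complex \<Rightarrow> (nat \<Rightarrow> real) \<Rightarrow> complex" where
  "lattice_monomial n \<alpha> z x = of_real (\<Prod>i<n. x i ^ \<alpha> i) * exp (\<i> * pi * z * of_real (sqnorm n x))"

lemma lattice_monomial_shifted_vector:
  "lattice_monomial n \<alpha> z (shifted_vector n s m) = (\<Prod>i<n. theta_term False s (\<alpha> i) z (m i))"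
proof -
  have "\<i> * pi * z * of_real (sqnorm n (shifted_vector n s m)) =
      (\<Sum>i<n. \<i> * pi * z * of_real ((of_int (m i) + s)\<^sup>2))"
    by (simp add: sqnorm_def shifted_vector_def sum_distrib_left)
  thus ?thesis
    by (simp add: lattice_monomial_def theta_term_def exp_sum prod.distrib shifted_vector_def)
qed

text \<open>Evenness is imposed by averaging over the sign character: (1 + (-1)^t) / 2, with t the
  coordinate sum, is its indicator, and both summands factor over the coordinates.\<close>

lemma has_sum_even_vectors:
  assumes z: "Im z > 0"
  shows "((\<lambda>m. \<Prod>i<n. theta_term False s (\<alpha> i) z (m i)) has_sum
     ((\<Prod>i<n. theta_moment False s (\<alpha> i) z) + (\<Prod>i<n. theta_moment True s (\<alpha> i) z)) / 2) (even_vectors n)"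
proof -
  let ?f = "\<lambda>b m. \<Prod>i<n. theta_term b s (\<alpha> i) z (m i)"
  have "((\<lambda>m. (?f False m + ?f True m) * (1/2)) has_sum
     ((\<Prod>i<n. theta_moment False s (\<alpha> i) z) + (\<Prod>i<n. theta_moment True s (\<alpha> i) z)) * (1/2)) (PiE {..<n} (\<lambda>_. UNIV))"
    unfolding theta_moment_def
    by (intro has_sum_cmult_left has_sum_add has_sum_prod_PiE abs_summable_theta_term z) auto
  also have "?this \<longleftrightarrow> (?f False has_sum
     ((\<Prod>i<n. theta_moment False s (\<alpha> i) z) + (\<Prod>i<n. theta_moment True s (\<alpha> i) z)) * (1/2)) (even_vectors n)"
  proof (rule has_sum_cong_neutral)
    have tw: "?f True m = twist True (\<Sum>i<n. m i) * ?f False m" for m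
      by (simp add: theta_term_def twist_sum prod.distrib mult.assoc)
    show "(?f False m + ?f True m) * (1/2) = 0" if "m \<in> PiE {..<n} (\<lambda>_. UNIV) - even_vectors n" for m
      using that unfolding tw by (auto simp: even_vectors_def twist_def)
    show "(?f False m + ?f True m) * (1/2) = ?f False m" if "m \<in> PiE {..<n} (\<lambda>_. UNIV) \<inter> even_vectors n" for m
      using that unfolding tw by (auto simp: even_vectors_def twist_def)
  qed (auto simp: even_vectors_def)
  finally show ?thesis by simp
qed

lemma has_sum_lattice_monomial:
  assumes n: "n > 0" "4 dvd n" and z: "Im z > 0"
  shows "(lattice_monomial n \<alpha> z has_sum
     ((\<Prod>i<n. theta_moment False 0 (\<alpha> i) z) + (\<Prod>i<n. theta_moment True 0 (\<alpha> i) z)) / 2 +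
     ((\<Prod>i<n. theta_moment False (1/2) (\<alpha> i) z) + (\<Prod>i<n. theta_moment True (1/2) (\<alpha> i) z)) / 2) (witt_lattice n)"
  unfolding witt_lattice_eq[OF n]
  by (intro has_sum_Un_disjoint shifted_vector_disjoint[OF n(1)])
    (auto simp: has_sum_reindex[OF inj_on_shifted_vector] o_def lattice_monomial_shifted_vector
      intro: has_sum_even_vectors[OF z])

lemma has_sum_sum:
  fixes f :: "'a \<Rightarrow> 'b \<Rightarrow> complex"
  assumes "finite S" "\<And>a. a \<in> S \<Longrightarrow> (f a has_sum l a) A"
  shows "((\<lambda>x. \<Sum>a\<in>S. f a x) has_sum (\<Sum>a\<in>S. l a)) A"
  using assms by (induction S rule: finite_induct) (auto intro: has_sum_add has_sum_0)

lemma lattice_theta_poly: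
  assumes n: "n > 0" "4 dvd n" and z: "Im z > 0" and P: "finite {\<alpha>. P \<alpha> \<noteq> 0}"
  shows "lattice_theta n (witt_lattice n) (poly_eval n P) z =
    (\<Sum>\<alpha>\<in>{\<alpha>. P \<alpha> \<noteq> 0}. of_real (P \<alpha>) *
     (((\<Prod>i<n. theta_moment False 0 (\<alpha> i) z) + (\<Prod>i<n. theta_moment True 0 (\<alpha> i) z)) / 2 +
     ((\<Prod>i<n. theta_moment False (1/2) (\<alpha> i) z) + (\<Prod>i<n. theta_moment True (1/2) (\<alpha> i) z)) / 2))"
  unfolding lattice_theta_def
proof (rule infsumI)
  have *: "(\<lambda>x. of_real (poly_eval n P x) * exp (\<i> * pi * z * of_real (sqnorm n x))) =
      (\<lambda>x. \<Sum>\<alpha>\<in>{\<alpha>. P \<alpha> \<noteq> 0}. of_real (P \<alpha>) * lattice_monomial n \<alpha> z x)"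
    by (simp add: fun_eq_iff poly_eval_def lattice_monomial_def sum_distrib_right mult.assoc)
  show "((\<lambda>x. of_real (poly_eval n P x) * exp (\<i> * pi * z * of_real (sqnorm n x))) has_sum
    (\<Sum>\<alpha>\<in>{\<alpha>. P \<alpha> \<noteq> 0}. of_real (P \<alpha>) *
     (((\<Prod>i<n. theta_moment False 0 (\<alpha> i) z) + (\<Prod>i<n. theta_moment True 0 (\<alpha> i) z)) / 2 +
     ((\<Prod>i<n. theta_moment False (1/2) (\<alpha> i) z) + (\<Prod>i<n. theta_moment True (1/2) (\<alpha> i) z)) / 2)))
    (witt_lattice n)"
    unfolding * by (intro has_sum_sum[OF P] has_sum_cmult_right has_sum_lattice_monomial n z)
qed

lemma lattice_theta_one:
  assumes n: "n > 0" "4 dvd n" and z: "Im z > 0"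
  shows "lattice_theta n (witt_lattice n) (\<lambda>_. 1) z = (theta2 z ^ n + theta3 z ^ n + theta4 z ^ n) / 2"
proof -
  have "lattice_theta n (witt_lattice n) (\<lambda>_. 1) z = infsum (lattice_monomial n (\<lambda>_. 0) z) (witt_lattice n)"
    by (simp add: lattice_theta_def lattice_monomial_def[abs_def])
  \<comment> \<open>\<open>0 ^ n\<close> is the contribution of the twisted half-integers.\<close>
  also have "\<dots> = (theta3 z ^ n + theta4 z ^ n) / 2 + (theta2 z ^ n + 0 ^ n) / 2"
    using infsumI[OF has_sum_lattice_monomial[OF n z, of "\<lambda>_. 0"]]
    by (simp add: theta2_eq theta3_eq theta4_eq theta_moment_even_half_twisted)
  finally show ?thesis using n by (simp add: power_0_left add_divide_distrib)
qed

subsection \<open>Harmonic polynomials\<close>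

definition pure_power :: "nat \<Rightarrow> nat \<Rightarrow> nat \<Rightarrow> nat" where
  "pure_power d i = (\<lambda>_. 0)(i := d)"

text \<open>The value at the Laplacian of the monomial with exponents \<alpha> of the functional
  given by \<psi> on monomials. Truncated subtraction is harmless: the coefficient vanishes for
  exponents 0 and 1.\<close>

definition laplacian_adjoint :: "nat \<Rightarrow> ((nat \<Rightarrow> nat) \<Rightarrow> complex) \<Rightarrow> (nat \<Rightarrow> nat) \<Rightarrow> complex" where
  "laplacian_adjoint n \<psi> \<alpha> = (\<Sum>i<n. of_nat (\<alpha> i * (\<alpha> i - 1)) * \<psi> (\<alpha>(i := \<alpha> i - 2)))"

text \<open>Summation by parts: lowering an exponent for \<psi> amounts to raising it for P, so the
  sum is \<psi> applied to the Laplacian of P.\<close>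

lemma sum_laplacian_adjoint_eq_0:
  assumes fin: "finite {\<alpha>. P \<alpha> \<noteq> 0}" and harm: "laplacian n P = (\<lambda>_. 0)"
  shows "(\<Sum>\<alpha>\<in>{\<alpha>. P \<alpha> \<noteq> 0}. of_real (P \<alpha>) * laplacian_adjoint n \<psi> \<alpha>) = 0"
proof -
  let ?A = "{\<alpha>. P \<alpha> \<noteq> 0}"
  define g where "g = (\<lambda>i \<alpha>. of_real (P \<alpha>) * (of_nat (\<alpha> i * (\<alpha> i - 1)) * \<psi> (\<alpha>(i := \<alpha> i - 2))))"
  \<comment> \<open>A finite set containing every exponent vector obtained from the support by
    lowering one entry by 2. Surplus elements do no harm, as raising them again leads either into
    the support or to a zero coefficient.\<close>
  define B where "B = (\<Union>i<n. (\<lambda>\<alpha>. \<alpha>(i := \<alpha> i - 2)) ` ?A)"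
  have finB: "finite B" unfolding B_def using fin by auto
  have g_sum: "(\<Sum>\<beta>\<in>B. g i (\<beta>(i := \<beta> i + 2))) = sum (g i) ?A" if i: "i < n" for i
  proof -
    let ?h = "\<lambda>\<beta>::nat \<Rightarrow> nat. \<beta>(i := \<beta> i + 2)"
    have inj: "inj_on ?h B"
      by (rule inj_onI) (metis add_right_cancel fun_upd_same fun_upd_triv fun_upd_upd)
    have "(\<Sum>\<beta>\<in>B. g i (?h \<beta>)) = sum (g i) (?h ` B)"
      by (subst sum.reindex[OF inj]) (simp add: o_def)
    also have "\<dots> = sum (g i) {\<alpha>\<in>?A. \<alpha> i \<ge> 2}"
    proof (rule sum.mono_neutral_right)
      show "finite (?h ` B)" using finB by simp
      show "{\<alpha>\<in>?A. \<alpha> i \<ge> 2} \<subseteq> ?h ` B"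
      proof
        fix \<alpha> assume a: "\<alpha> \<in> {\<alpha>\<in>?A. \<alpha> i \<ge> 2}"
        hence "\<alpha>(i := \<alpha> i - 2) \<in> B" using i by (auto simp: B_def)
        moreover have "\<alpha> = ?h (\<alpha>(i := \<alpha> i - 2))" using a by (auto simp: fun_eq_iff)
        ultimately show "\<alpha> \<in> ?h ` B" by blast
      qed
      show "\<forall>\<alpha>\<in>?h ` B - {\<alpha>\<in>?A. \<alpha> i \<ge> 2}. g i \<alpha> = 0"
        by (auto simp: g_def)
    qed
    also have "\<dots> = sum (g i) ?A"
    proof (rule sum.mono_neutral_left[OF fin])
      have "a * (a - 1) = 0" if "\<not> 2 \<le> a" for a :: nat
        using that by (cases a) auto
      thus "\<forall>\<alpha>\<in>?A - {\<alpha>\<in>?A. \<alpha> i \<ge> 2}. g i \<alpha> = 0"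
        by (auto simp only: g_def) simp
    qed auto
    finally show ?thesis .
  qed
  have "(\<Sum>\<alpha>\<in>?A. of_real (P \<alpha>) * laplacian_adjoint n \<psi> \<alpha>) = (\<Sum>i<n. sum (g i) ?A)"
    unfolding laplacian_adjoint_def g_def sum_distrib_left by (rule sum.swap)
  also have "\<dots> = (\<Sum>i<n. \<Sum>\<beta>\<in>B. g i (\<beta>(i := \<beta> i + 2)))"
    by (rule sum.cong) (simp_all only: g_sum lessThan_iff)
  also have "\<dots> = (\<Sum>\<beta>\<in>B. \<Sum>i<n. g i (\<beta>(i := \<beta> i + 2)))"
    by (rule sum.swap)
  also have "\<dots> = (\<Sum>\<beta>\<in>B. \<psi> \<beta> * of_real (laplacian n P \<beta>))"
    unfolding laplacian_def of_real_sum sum_distrib_left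
    by (intro sum.cong refl) (simp add: g_def algebra_simps)
  finally show ?thesis by (simp add: harm)
qed

lemma sum_pure_powers:
  fixes K :: complex
  assumes "d > 0" "finite {\<alpha>. P \<alpha> \<noteq> 0}"
  shows "(\<Sum>\<alpha>\<in>{\<alpha>. P \<alpha> \<noteq> 0}. of_real (P \<alpha>) * (if \<alpha> \<in> pure_power d ` {..<n} then K else 0)) =
    K * of_real (\<Sum>i<n. P (pure_power d i))" (is "?l = _")
proof -
  have inj: "inj_on (pure_power d) {..<n}"
    using assms(1) by (auto simp: inj_on_def pure_power_def fun_eq_iff split: if_splits)
  have "?l = (\<Sum>\<alpha>\<in>pure_power d ` {..<n}. of_real (P \<alpha>) * K)"
    by (rule sum.mono_neutral_cong) (use assms(2) in auto)
  also have "\<dots> = (\<Sum>i<n. of_real (P (pure_power d i)) * K)"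
    by (simp add: sum.reindex[OF inj])
  finally show ?thesis by (simp add: sum_distrib_left mult.commute)
qed

text \<open>Adjoint images of the Laplacian vanish on harmonic polynomials, so it suffices to find
  \<psi> for which the product functional differs from such an image only at the pure powers. Each
  degree below supplies its \<psi>.\<close>

lemma harmonic_sum_moments:
  assumes P: "P \<in> Harm n d" and d: "d > 0"
    and V: "\<And>\<alpha>. (\<And>i. i \<ge> n \<Longrightarrow> \<alpha> i = 0) \<Longrightarrow> (\<Sum>i<n. \<alpha> i) = d \<Longrightarrow>
      (\<Prod>i<n. V (\<alpha> i)) = laplacian_adjoint n \<psi> \<alpha> + (if \<alpha> \<in> pure_power d ` {..<n} then K else 0)"
  shows "(\<Sum>\<alpha>\<in>{\<alpha>. P \<alpha> \<noteq> 0}. of_real (P \<alpha>) * (\<Prod>i<n. V (\<alpha> i))) = K * of_real (\<Sum>i<n. P (pure_power d i))"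
proof -
  have fin: "finite {\<alpha>. P \<alpha> \<noteq> 0}" and harm: "laplacian n P = (\<lambda>_. 0)"
    using P by (auto simp: Harm_def is_rpoly_def)
  have V': "(\<Prod>i<n. V (\<alpha> i)) = laplacian_adjoint n \<psi> \<alpha> + (if \<alpha> \<in> pure_power d ` {..<n} then K else 0)"
      if "P \<alpha> \<noteq> 0" for \<alpha>
    using P that V[of \<alpha>] by (auto simp: Harm_def is_rpoly_def homogeneous_def)
  have *: "(\<Sum>\<alpha>\<in>{\<alpha>. P \<alpha> \<noteq> 0}. of_real (P \<alpha>) * (\<Prod>i<n. V (\<alpha> i))) =
     (\<Sum>\<alpha>\<in>{\<alpha>. P \<alpha> \<noteq> 0}. of_real (P \<alpha>) * laplacian_adjoint n \<psi> \<alpha> +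
       of_real (P \<alpha>) * (if \<alpha> \<in> pure_power d ` {..<n} then K else 0))"
    by (intro sum.cong refl) (auto simp: V' distrib_left)
  show ?thesis
    unfolding * sum.distrib sum_laplacian_adjoint_eq_0[OF fin harm] sum_pure_powers[OF d fin] by simp
qed

section \<open>Exponent vectors with even entries, sorted by the partition of the degree\<close>

lemma even_exponents_split:
  fixes \<alpha> :: "nat \<Rightarrow> nat"
  assumes "\<And>i. i \<ge> n \<Longrightarrow> \<alpha> i = 0" "\<And>i. even (\<alpha> i)" "(\<Sum>i<n. \<alpha> i) = d" "d > 0"
  obtains i a \<beta> where "i < n" "even a" "a > 0" "a \<le> d" "\<alpha> = \<beta>(i := a)" "\<beta> i = 0"
    "\<And>i. i \<ge> n \<Longrightarrow> \<beta> i = 0" "\<And>i. even (\<beta> i)" "(\<Sum>i<n. \<beta> i) = d - a"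
proof -
  obtain i where i: "i < n" "\<alpha> i > 0"
    using assms(3,4) by (metis gr0I lessThan_iff sum.neutral)
  have "(\<Sum>k<n. \<alpha> k) = \<alpha> i + (\<Sum>k\<in>{..<n} - {i}. \<alpha> k)"
    using i by (simp add: sum.remove[of _ i])
  moreover have "(\<Sum>k<n. (\<alpha>(i := 0)) k) = (\<Sum>k\<in>{..<n} - {i}. \<alpha> k)"
    using i by (simp add: sum.remove[of _ i])
  ultimately show ?thesis
    using i assms by (intro that[of i "\<alpha> i" "\<alpha>(i := 0)"]) auto
qed

lemma even_exponents_sum_0:
  fixes \<alpha> :: "nat \<Rightarrow> nat"
  assumes "\<And>i. i \<ge> n \<Longrightarrow> \<alpha> i = 0" "(\<Sum>i<n. \<alpha> i) = 0"
  shows "\<alpha> = (\<lambda>_. 0)"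
proof
  fix i show "\<alpha> i = 0" using assms by (cases "i < n") auto
qed

lemma even_exponents_sum_2:
  fixes \<alpha> :: "nat \<Rightarrow> nat"
  assumes "\<And>i. i \<ge> n \<Longrightarrow> \<alpha> i = 0" "\<And>i. even (\<alpha> i)" "(\<Sum>i<n. \<alpha> i) = 2"
  obtains i where "i < n" "\<alpha> = (\<lambda>_. 0)(i := 2)"
proof -
  obtain i a \<beta> where *: "i < n" "even a" "a > 0" "a \<le> 2" "\<alpha> = \<beta>(i := a)" "\<beta> i = 0"
    "\<And>i. i \<ge> n \<Longrightarrow> \<beta> i = 0" "\<And>i. even (\<beta> i)" "(\<Sum>i<n. \<beta> i) = 2 - a"
    using even_exponents_split[OF assms] by auto
  have "a = 2" using *(2-4) by presburger
  moreover from this have "\<beta> = (\<lambda>_. 0)" using * by (intro even_exponents_sum_0) auto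
  ultimately show ?thesis using * that by simp
qed

lemma even_exponents_sum_4:
  fixes \<alpha> :: "nat \<Rightarrow> nat"
  assumes "\<And>i. i \<ge> n \<Longrightarrow> \<alpha> i = 0" "\<And>i. even (\<alpha> i)" "(\<Sum>i<n. \<alpha> i) = 4"
  obtains i where "i < n" "\<alpha> = (\<lambda>_. 0)(i := 4)"
    | i j where "i < n" "j < n" "i \<noteq> j" "\<alpha> = (\<lambda>_. 0)(i := 2, j := 2)"
proof -
  obtain i a \<beta> where *: "i < n" "even a" "a > 0" "a \<le> 4" "\<alpha> = \<beta>(i := a)" "\<beta> i = 0"
    "\<And>i. i \<ge> n \<Longrightarrow> \<beta> i = 0" "\<And>i. even (\<beta> i)" "(\<Sum>i<n. \<beta> i) = 4 - a"
    using even_exponents_split[OF assms] by auto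
  have "a = 4 \<or> a = 2" using *(2-4) by presburger
  thus ?thesis
  proof
    assume "a = 4"
    moreover from this have "\<beta> = (\<lambda>_. 0)" using * by (intro even_exponents_sum_0) auto
    ultimately show ?thesis using * that(1) by simp
  next
    assume a: "a = 2"
    then obtain j where j: "j < n" "\<beta> = (\<lambda>_. 0)(j := 2)"
      using even_exponents_sum_2[of n \<beta>] * by auto
    hence "i \<noteq> j" using *(6) by auto
    thus ?thesis using * j a that(2)[of j i] by auto
  qed
qed

lemma even_exponents_sum_6:
  fixes \<alpha> :: "nat \<Rightarrow> nat"
  assumes "\<And>i. i \<ge> n \<Longrightarrow> \<alpha> i = 0" "\<And>i. even (\<alpha> i)" "(\<Sum>i<n. \<alpha> i) = 6"
  obtains i where "i < n" "\<alpha> = (\<lambda>_. 0)(i := 6)"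
    | i j where "i < n" "j < n" "i \<noteq> j" "\<alpha> = (\<lambda>_. 0)(i := 4, j := 2)"
    | i j k where "i < n" "j < n" "k < n" "i \<noteq> j" "i \<noteq> k" "j \<noteq> k" "\<alpha> = (\<lambda>_. 0)(i := 2, j := 2, k := 2)"
proof -
  obtain i a \<beta> where *: "i < n" "even a" "a > 0" "a \<le> 6" "\<alpha> = \<beta>(i := a)" "\<beta> i = 0"
    "\<And>i. i \<ge> n \<Longrightarrow> \<beta> i = 0" "\<And>i. even (\<beta> i)" "(\<Sum>i<n. \<beta> i) = 6 - a"
    using even_exponents_split[OF assms] by auto
  have "a = 6 \<or> a = 4 \<or> a = 2" using *(2-4) by presburger
  thus ?thesis
  proof (elim disjE)
    assume "a = 6"
    moreover from this have "\<beta> = (\<lambda>_. 0)" using * by (intro even_exponents_sum_0) auto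
    ultimately show ?thesis using * that(1) by simp
  next
    assume a: "a = 4"
    then obtain j where j: "j < n" "\<beta> = (\<lambda>_. 0)(j := 2)"
      using even_exponents_sum_2[of n \<beta>] * by auto
    hence "i \<noteq> j" using *(6) by auto
    thus ?thesis using * j a that(2)[of i j] by (auto simp: fun_upd_twist)
  next
    assume a: "a = 2"
    have "(\<Sum>i<n. \<beta> i) = 4" using *(9) a by simp
    from *(7,8) this show ?thesis
    proof (rule even_exponents_sum_4)
      fix j assume j: "j < n" "\<beta> = (\<lambda>_. 0)(j := 4)"
      hence "i \<noteq> j" using *(6) by auto
      thus ?thesis using * j a that(2)[of j i] by auto
    next
      fix j k assume jk: "j < n" "k < n" "j \<noteq> k" "\<beta> = (\<lambda>_. 0)(j := 2, k := 2)"
      hence "i \<noteq> j" "i \<noteq> k" using *(6) by (auto split: if_splits)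
      thus ?thesis using * jk a that(3)[of j k i] by auto
    qed
  qed
qed

lemma prod_fun_upd:
  fixes V :: "nat \<Rightarrow> complex" and i n :: nat
  assumes "i < n" "\<beta> i = 0" "V 0 = 1"
  shows "(\<Prod>k<n. V ((\<beta>(i := a)) k)) = V a * (\<Prod>k<n. V (\<beta> k))"
proof -
  have *: "(\<Prod>k<n. V (\<gamma> k)) = V (\<gamma> i) * (\<Prod>k\<in>{..<n} - {i}. V (\<gamma> k))" for \<gamma>
    using assms(1) by (intro prod.remove finite_lessThan) simp
  show ?thesis using *[of "\<beta>(i := a)"] *[of \<beta>] assms(2,3) by simp
qed

lemma laplacian_adjoint_support:
  assumes "A \<subseteq> {..<n}" "\<And>i. i \<notin> A \<Longrightarrow> \<alpha> i = 0"
  shows "laplacian_adjoint n \<psi> \<alpha> = (\<Sum>i\<in>A. of_nat (\<alpha> i * (\<alpha> i - 1)) * \<psi> (\<alpha>(i := \<alpha> i - 2)))"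
  unfolding laplacian_adjoint_def by (rule sum.mono_neutral_right) (use assms in auto)

text \<open>Lowering an exponent by 2 keeps its parity, so each term with nonzero coefficient
  evaluates \<psi> at a vector that still has an odd entry.\<close>

lemma laplacian_adjoint_odd:
  assumes \<psi>: "\<And>\<beta>. \<exists>i. odd (\<beta> i) \<Longrightarrow> \<psi> \<beta> = 0" and "odd (\<alpha> k)"
  shows "laplacian_adjoint n \<psi> \<alpha> = 0"
  unfolding laplacian_adjoint_def
proof (intro sum.neutral ballI)
  fix i
  show "of_nat (\<alpha> i * (\<alpha> i - 1)) * \<psi> (\<alpha>(i := \<alpha> i - 2)) = 0"
  proof (cases "\<alpha> i \<ge> 2")
    case True
    hence "odd ((\<alpha>(i := \<alpha> i - 2)) k)" using assms(2) by auto
    hence "\<psi> (\<alpha>(i := \<alpha> i - 2)) = 0" by (intro \<psi>) blast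
    thus ?thesis by simp
  next
    case False
    hence "\<alpha> i = 0 \<or> \<alpha> i = 1" by auto
    thus ?thesis by auto
  qed
qed

lemma odd_not_pure_power: "even d \<Longrightarrow> odd (\<alpha> k) \<Longrightarrow> \<alpha> \<notin> pure_power d ` A"
  by (auto simp: pure_power_def split: if_splits)

lemma not_pure_power: "i \<noteq> j \<Longrightarrow> \<alpha> i \<noteq> 0 \<Longrightarrow> \<alpha> j \<noteq> 0 \<Longrightarrow> \<alpha> \<notin> pure_power d ` A"
  by (auto simp: pure_power_def split: if_splits)

section \<open>Reduction of product functionals to cumulants in degrees 2, 4 and 6\<close>

context
  fixes V :: "nat \<Rightarrow> complex" and n :: nat
  assumes V0: "V 0 = 1" and Vodd: "\<And>a. odd a \<Longrightarrow> V a = 0"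
begin

private lemma moments_identity_odd:
  assumes "\<And>\<beta>. \<exists>i. odd (\<beta> i) \<Longrightarrow> \<psi> \<beta> = 0" "even d" "\<And>i. i \<ge> n \<Longrightarrow> \<alpha> i = 0" "odd (\<alpha> k)"
  shows "(\<Prod>i<n. V (\<alpha> i)) = laplacian_adjoint n \<psi> \<alpha> + (if \<alpha> \<in> pure_power d ` {..<n} then K else 0)"
proof -
  have "k < n" using assms(3,4) by (metis even_zero not_le)
  hence "(\<Prod>i<n. V (\<alpha> i)) = 0" using Vodd[OF assms(4)] by (intro prod_zero) auto
  moreover have "laplacian_adjoint n \<psi> \<alpha> = 0"
    by (rule laplacian_adjoint_odd[where k = k]) (use assms(1,4) in blast)+
  ultimately show ?thesis using odd_not_pure_power[of d \<alpha> k] assms(2,4) by simp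
qed

lemma harmonic_moments_2:
  assumes "P \<in> Harm n 2"
  shows "(\<Sum>\<alpha>\<in>{\<alpha>. P \<alpha> \<noteq> 0}. of_real (P \<alpha>) * (\<Prod>i<n. V (\<alpha> i))) = 0"
proof -
  \<comment> \<open>The Laplacian of x_i^2 is 2, hence the half; nothing is left for the pure
    powers.\<close>
  let ?\<psi> = "\<lambda>\<beta>::nat\<Rightarrow>nat. if \<exists>i. odd (\<beta> i) then 0 else V 2 / 2"
  have "(\<Sum>\<alpha>\<in>{\<alpha>. P \<alpha> \<noteq> 0}. of_real (P \<alpha>) * (\<Prod>i<n. V (\<alpha> i))) = 0 * of_real (\<Sum>i<n. P (pure_power 2 i))"
  proof (rule harmonic_sum_moments[OF assms, where \<psi> = ?\<psi>])
    fix \<alpha> :: "nat \<Rightarrow> nat" assume \<alpha>: "\<And>i. i \<ge> n \<Longrightarrow> \<alpha> i = 0" "(\<Sum>i<n. \<alpha> i) = 2"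
    show "(\<Prod>i<n. V (\<alpha> i)) = laplacian_adjoint n ?\<psi> \<alpha> + (if \<alpha> \<in> pure_power 2 ` {..<n} then 0 else 0)"
    proof (cases "\<exists>k. odd (\<alpha> k)")
      case True
      then obtain k where "odd (\<alpha> k)" by blast
      thus ?thesis using \<alpha>(1) by (intro moments_identity_odd) auto
    next
      case False
      from \<alpha>(1) obtain i where i: "i < n" "\<alpha> = (\<lambda>_. 0)(i := 2)"
        by (rule even_exponents_sum_2[OF _ _ \<alpha>(2)]) (use False in auto)
      have "laplacian_adjoint n ?\<psi> \<alpha> = V 2"
        by (subst laplacian_adjoint_support[of "{i}"]) (use i in auto)
      thus ?thesis using i by (simp add: prod_fun_upd V0 del: fun_upd_apply)
    qed
  qed simp
  thus ?thesis by simp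
qed

lemma harmonic_moments_4:
  assumes "P \<in> Harm n 4"
  shows "(\<Sum>\<alpha>\<in>{\<alpha>. P \<alpha> \<noteq> 0}. of_real (P \<alpha>) * (\<Prod>i<n. V (\<alpha> i))) =
    (V 4 - 3 * V 2 ^ 2) * of_real (\<Sum>i<n. P (pure_power 4 i))"
proof -
  \<comment> \<open>Type (2,2) requires 2 \<psi> + 2 \<psi> = (V 2)^2. The pure power x_i^4 then
    receives 12 \<psi> = 3 (V 2)^2, and the shortfall is \<open>?K\<close>.\<close>
  let ?\<psi> = "\<lambda>\<beta>::nat\<Rightarrow>nat. if \<exists>i. odd (\<beta> i) then 0 else V 2 ^ 2 / 4"
  let ?K = "V 4 - 3 * V 2 ^ 2"
  show ?thesis
  proof (rule harmonic_sum_moments[OF assms, where \<psi> = ?\<psi>])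
    fix \<alpha> :: "nat \<Rightarrow> nat" assume \<alpha>: "\<And>i. i \<ge> n \<Longrightarrow> \<alpha> i = 0" "(\<Sum>i<n. \<alpha> i) = 4"
    show "(\<Prod>i<n. V (\<alpha> i)) = laplacian_adjoint n ?\<psi> \<alpha> + (if \<alpha> \<in> pure_power 4 ` {..<n} then ?K else 0)"
    proof (cases "\<exists>k. odd (\<alpha> k)")
      case True
      then obtain k where "odd (\<alpha> k)" by blast
      thus ?thesis using \<alpha>(1) by (intro moments_identity_odd) auto
    next
      case False
      from \<alpha>(1) show ?thesis
      proof (rule even_exponents_sum_4[OF _ _ \<alpha>(2)])
        fix i assume i: "i < n" "\<alpha> = (\<lambda>_. 0)(i := 4)"
        have "laplacian_adjoint n ?\<psi> \<alpha> = 3 * V 2 ^ 2"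
          by (subst laplacian_adjoint_support[of "{i}"]) (use i in auto)
        moreover have "\<alpha> \<in> pure_power 4 ` {..<n}" using i by (auto simp: pure_power_def)
        ultimately show ?thesis using i by (simp add: prod_fun_upd V0 del: fun_upd_apply)
      next
        fix i j assume i: "i < n" "j < n" "i \<noteq> j" "\<alpha> = (\<lambda>_. 0)(i := 2, j := 2)"
        have "laplacian_adjoint n ?\<psi> \<alpha> = V 2 ^ 2"
          by (subst laplacian_adjoint_support[of "{i, j}"]) (use i in auto)
        moreover have "\<alpha> \<notin> pure_power 4 ` {..<n}"
          using i by (intro not_pure_power[of i j]) auto
        moreover have "(\<Prod>i<n. V (\<alpha> i)) = V 2 ^ 2"
          using prod_fun_upd[of j n "(\<lambda>_. 0)(i := 2)" V 2] prod_fun_upd[of i n "\<lambda>_. 0" V 2] i V0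
          by (simp add: power2_eq_square)
        ultimately show ?thesis by simp
      qed (use False in auto)
    qed
  qed simp
qed

lemma harmonic_moments_6:
  assumes "P \<in> Harm n 6"
  shows "(\<Sum>\<alpha>\<in>{\<alpha>. P \<alpha> \<noteq> 0}. of_real (P \<alpha>) * (\<Prod>i<n. V (\<alpha> i))) =
    (V 6 - 15 * V 2 * V 4 + 30 * V 2 ^ 3) * of_real (\<Sum>i<n. P (pure_power 6 i))"
proof -
  \<comment> \<open>\<open>6 r = V 2 ^ 3\<close> and \<open>12 r + 2 p = V 2 * V 4\<close>: the exponent types (2,2,2) and (4,2) then cancel.\<close>
  define p r where "p = (V 2 * V 4 - 2 * V 2 ^ 3) / 2" and "r = V 2 ^ 3 / 6"
  define \<psi> where "\<psi> = (\<lambda>\<beta>::nat\<Rightarrow>nat. if \<exists>i. odd (\<beta> i) then 0 else if \<exists>i. \<beta> i = 4 then p else r)"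
  have \<psi>_odd: "\<psi> \<beta> = 0" if "\<exists>i. odd (\<beta> i)" for \<beta> using that by (simp add: \<psi>_def)
  have \<psi>_4: "\<psi> ((\<lambda>_. 0)(i := 4)) = p" for i by (auto simp: \<psi>_def)
  have \<psi>_22: "\<psi> ((\<lambda>_. 0)(i := 2, j := 2)) = r" for i j by (auto simp: \<psi>_def)
  let ?K = "V 6 - 15 * V 2 * V 4 + 30 * V 2 ^ 3"
  show ?thesis
  proof (rule harmonic_sum_moments[OF assms, where \<psi> = \<psi>])
    fix \<alpha> :: "nat \<Rightarrow> nat" assume \<alpha>: "\<And>i. i \<ge> n \<Longrightarrow> \<alpha> i = 0" "(\<Sum>i<n. \<alpha> i) = 6"
    show "(\<Prod>i<n. V (\<alpha> i)) = laplacian_adjoint n \<psi> \<alpha> + (if \<alpha> \<in> pure_power 6 ` {..<n} then ?K else 0)"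
    proof (cases "\<exists>k. odd (\<alpha> k)")
      case True
      then obtain k where "odd (\<alpha> k)" by blast
      thus ?thesis using \<alpha>(1) \<psi>_odd by (intro moments_identity_odd) auto
    next
      case False
      from \<alpha>(1) show ?thesis
      proof (rule even_exponents_sum_6[OF _ _ \<alpha>(2)])
        fix i assume i: "i < n" "\<alpha> = (\<lambda>_. 0)(i := 6)"
        \<comment> \<open>With p and r already fixed by the mixed types, the pure power absorbs the
          remainder V 6 - 30 p.\<close>
        have "laplacian_adjoint n \<psi> \<alpha> = 30 * p"
          by (subst laplacian_adjoint_support[of "{i}"]) (use i in \<open>auto simp: \<psi>_4\<close>)
        moreover have "\<alpha> \<in> pure_power 6 ` {..<n}" using i by (auto simp: pure_power_def)
        moreover have "30 * p = 15 * V 2 * V 4 - 30 * V 2 ^ 3" by (simp add: p_def)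
        ultimately show ?thesis using i by (simp add: prod_fun_upd V0 del: fun_upd_apply)
      next
        fix i j assume i: "i < n" "j < n" "i \<noteq> j" "\<alpha> = (\<lambda>_. 0)(i := 4, j := 2)"
        have "\<alpha>(i := 2) = (\<lambda>_. 0)(i := 2, j := 2)" "\<alpha>(j := 0) = (\<lambda>_. 0)(i := 4)"
          using i by auto
        hence "laplacian_adjoint n \<psi> \<alpha> = 12 * r + 2 * p"
          using i(1-3) laplacian_adjoint_support[of "{i, j}" n \<alpha> \<psi>] by (simp add: i(4) \<psi>_4 \<psi>_22)
        moreover have "\<alpha> \<notin> pure_power 6 ` {..<n}"
          using i by (intro not_pure_power[of i j]) auto
        moreover have "(\<Prod>i<n. V (\<alpha> i)) = V 2 * V 4"
          using prod_fun_upd[of j n "(\<lambda>_. 0)(i := 4)" V 2] prod_fun_upd[of i n "\<lambda>_. 0" V 4] i V0 by simp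
        ultimately show ?thesis by (simp add: p_def r_def field_simps)
      next
        fix i j k assume i: "i < n" "j < n" "k < n" "i \<noteq> j" "i \<noteq> k" "j \<noteq> k" "\<alpha> = (\<lambda>_. 0)(i := 2, j := 2, k := 2)"
        have "\<alpha>(i := 0) = (\<lambda>_. 0)(j := 2, k := 2)" "\<alpha>(j := 0) = (\<lambda>_. 0)(i := 2, k := 2)"
            "\<alpha>(k := 0) = (\<lambda>_. 0)(i := 2, j := 2)"
          using i by auto
        hence "laplacian_adjoint n \<psi> \<alpha> = 6 * r"
          using i(1-6) laplacian_adjoint_support[of "{i, j, k}" n \<alpha> \<psi>] by (simp add: i(7) \<psi>_22)
        moreover have "\<alpha> \<notin> pure_power 6 ` {..<n}"
          using i by (intro not_pure_power[of i j]) auto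
        moreover have "(\<Prod>i<n. V (\<alpha> i)) = V 2 ^ 3"
          using prod_fun_upd[of k n "(\<lambda>_. 0)(i := 2, j := 2)" V 2] prod_fun_upd[of j n "(\<lambda>_. 0)(i := 2)" V 2]
            prod_fun_upd[of i n "\<lambda>_. 0" V 2] i V0 by (simp add: power3_eq_cube)
        ultimately show ?thesis by (simp add: r_def)
      qed (use False in auto)
    qed
  qed simp
qed

end

subsection \<open>Theta series with harmonic coefficients\<close>

definition poly3 :: "(nat \<Rightarrow> nat \<Rightarrow> nat \<Rightarrow> real) \<Rightarrow> rpoly" where
  "poly3 p \<alpha> = (if \<forall>i\<ge>3. \<alpha> i = 0 then p (\<alpha> 0) (\<alpha> 1) (\<alpha> 2) else 0)"

lemma poly3_nonzeroD: "poly3 p \<alpha> \<noteq> 0 \<Longrightarrow> i \<ge> 3 \<Longrightarrow> \<alpha> i = 0"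
  by (auto simp: poly3_def split: if_splits)

lemma sum_over_three:
  fixes f :: "nat \<Rightarrow> 'a :: comm_monoid_add"
  assumes "n \<ge> 3" "\<And>i. i \<ge> 3 \<Longrightarrow> f i = 0"
  shows "(\<Sum>i<n. f i) = f 0 + f 1 + f 2"
proof -
  have "(\<Sum>i<n. f i) = (\<Sum>i<3. f i)"
    by (rule sum.mono_neutral_right) (use assms in auto)
  thus ?thesis by (simp add: numeral_3_eq_3 numeral_2_eq_2)
qed

lemma poly3_in_Harm:
  assumes n: "n \<ge> 3" and deg: "\<And>a b c. p a b c \<noteq> 0 \<Longrightarrow> a + b + c = d"
    and harm: "\<And>a b c. real ((a + 2) * (a + 1)) * p (a + 2) b c + real ((b + 2) * (b + 1)) * p a (b + 2) c +
      real ((c + 2) * (c + 1)) * p a b (c + 2) = 0"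
  shows "poly3 p \<in> Harm n d"
proof -
  have sum3: "(\<Sum>i<n. \<alpha> i) = \<alpha> 0 + \<alpha> 1 + \<alpha> 2" if "poly3 p \<alpha> \<noteq> 0" for \<alpha>
    using poly3_nonzeroD[OF that] n by (intro sum_over_three) auto
  have "{\<alpha>. poly3 p \<alpha> \<noteq> 0} \<subseteq> (\<lambda>(a, b, c). (\<lambda>_. 0)(0 := a, 1 := b, 2 := c)) ` ({..d} \<times> {..d} \<times> {..d})"
  proof
    fix \<alpha> assume "\<alpha> \<in> {\<alpha>. poly3 p \<alpha> \<noteq> 0}"
    hence \<alpha>: "poly3 p \<alpha> \<noteq> 0" by simp
    hence "p (\<alpha> 0) (\<alpha> 1) (\<alpha> 2) \<noteq> 0" by (auto simp: poly3_def split: if_splits)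
    hence "(\<alpha> 0, \<alpha> 1, \<alpha> 2) \<in> {..d} \<times> {..d} \<times> {..d}" using deg by fastforce
    moreover have "\<alpha> = (\<lambda>_. 0)(0 := \<alpha> 0, 1 := \<alpha> 1, 2 := \<alpha> 2)"
    proof
      fix i :: nat
      have "i = 0 \<or> i = 1 \<or> i = 2 \<or> i \<ge> 3" by linarith
      thus "\<alpha> i = ((\<lambda>_. 0)(0 := \<alpha> 0, 1 := \<alpha> 1, 2 := \<alpha> 2)) i"
        using poly3_nonzeroD[OF \<alpha>] by auto
    qed
    ultimately show "\<alpha> \<in> (\<lambda>(a, b, c). (\<lambda>_. 0)(0 := a, 1 := b, 2 := c)) ` ({..d} \<times> {..d} \<times> {..d})"
      unfolding image_iff by (intro bexI[of _ "(\<alpha> 0, \<alpha> 1, \<alpha> 2)"]) (simp_all only: prod.case)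
  qed
  hence "finite {\<alpha>. poly3 p \<alpha> \<noteq> 0}" by (rule finite_subset) auto
  moreover have "\<forall>\<alpha>. poly3 p \<alpha> \<noteq> 0 \<longrightarrow> (\<forall>i\<ge>n. \<alpha> i = 0)"
    using poly3_nonzeroD n by (meson order_trans)
  moreover have "homogeneous n d (poly3 p)"
    unfolding homogeneous_def
  proof (intro allI impI)
    fix \<alpha> assume \<alpha>: "poly3 p \<alpha> \<noteq> 0"
    hence "p (\<alpha> 0) (\<alpha> 1) (\<alpha> 2) \<noteq> 0" by (auto simp: poly3_def split: if_splits)
    thus "(\<Sum>i<n. \<alpha> i) = d" using sum3[OF \<alpha>] deg by simp
  qed
  moreover have "laplacian n (poly3 p) \<beta> = 0" for \<beta>
  proof -
    have zero: "poly3 p (\<beta>(i := \<beta> i + 2)) = 0" if "i \<ge> 3" for i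
      using poly3_nonzeroD[of p "\<beta>(i := \<beta> i + 2)" i] that by auto
    have "laplacian n (poly3 p) \<beta> = real ((\<beta> 0 + 2) * (\<beta> 0 + 1)) * poly3 p (\<beta>(0 := \<beta> 0 + 2)) +
        real ((\<beta> 1 + 2) * (\<beta> 1 + 1)) * poly3 p (\<beta>(1 := \<beta> 1 + 2)) +
        real ((\<beta> 2 + 2) * (\<beta> 2 + 1)) * poly3 p (\<beta>(2 := \<beta> 2 + 2))"
      unfolding laplacian_def using n zero by (intro sum_over_three) auto
    also have "\<dots> = 0"
    proof (cases "\<forall>i\<ge>3. \<beta> i = 0")
      case True
      hence "poly3 p (\<beta>(0 := \<beta> 0 + 2)) = p (\<beta> 0 + 2) (\<beta> 1) (\<beta> 2)"
        "poly3 p (\<beta>(1 := \<beta> 1 + 2)) = p (\<beta> 0) (\<beta> 1 + 2) (\<beta> 2)"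
        "poly3 p (\<beta>(2 := \<beta> 2 + 2)) = p (\<beta> 0) (\<beta> 1) (\<beta> 2 + 2)"
        by (auto simp: poly3_def)
      thus ?thesis using harm[of "\<beta> 0" "\<beta> 1" "\<beta> 2"] by (simp only:)
    next
      case False
      then obtain k where k: "k \<ge> 3" "\<beta> k \<noteq> 0" by blast
      have "poly3 p (\<beta>(i := \<beta> i + 2)) = 0" for i
        using poly3_nonzeroD[of p "\<beta>(i := \<beta> i + 2)" k] k by (cases "i = k") auto
      thus ?thesis by simp
    qed
    finally show ?thesis .
  qed
  ultimately show ?thesis by (auto simp: Harm_def is_rpoly_def)
qed

lemma sum_poly3_pure_power:
  assumes "n \<ge> 3" "d > 0"
  shows "(\<Sum>i<n. poly3 p (pure_power d i)) = p d 0 0 + p 0 d 0 + p 0 0 d"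
proof -
  have "(\<Sum>i<n. poly3 p (pure_power d i)) = poly3 p (pure_power d 0) + poly3 p (pure_power d 1) + poly3 p (pure_power d 2)"
    using assms by (intro sum_over_three) (auto simp: poly3_def pure_power_def)
  thus ?thesis by (simp add: poly3_def pure_power_def)
qed

lemma Harm_4_witness:
  assumes "n \<ge> 3"
  shows "\<exists>P\<in>Harm n 4. (\<Sum>i<n. P (pure_power 4 i)) \<noteq> 0"
proof -
  \<comment> \<open>x^4 + y^4 + z^4 - 3 (x^2 y^2 + x^2 z^2 + y^2 z^2): the coefficient t of the
    mixed terms solves 12 + 2 t + 2 t = 0, from x^2 in the Laplacian.\<close>
  define p :: "nat \<Rightarrow> nat \<Rightarrow> nat \<Rightarrow> real" where
    "p a b c = (if a + b + c \<noteq> 4 \<or> odd a \<or> odd b \<or> odd c then 0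
       else if a = 4 \<or> b = 4 \<or> c = 4 then 1 else - 3)" for a b c
  have "poly3 p \<in> Harm n 4"
  proof (rule poly3_in_Harm[OF assms])
    show "a + b + c = 4" if "p a b c \<noteq> 0" for a b c
      using that by (auto simp: p_def split: if_splits)
    fix a b c :: nat
    show "real ((a + 2) * (a + 1)) * p (a + 2) b c + real ((b + 2) * (b + 1)) * p a (b + 2) c +
      real ((c + 2) * (c + 1)) * p a b (c + 2) = 0"
    proof (cases "a + b + c = 2")
      case True
      hence "a \<in> {0, 1, 2}" "b \<in> {0, 1, 2}" "c = 2 - a - b" by auto
      thus ?thesis using True by (auto simp: p_def)
    qed (auto simp: p_def)
  qed
  moreover have "(\<Sum>i<n. poly3 p (pure_power 4 i)) \<noteq> 0"
    by (subst sum_poly3_pure_power[OF assms]) (simp_all add: p_def)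
  ultimately show ?thesis by blast
qed

text \<open>In degree 6 two variables do not suffice: the pure powers in \<open>Re (x + \<i> y)^6\<close> have opposite signs.\<close>

lemma Harm_6_witness:
  assumes "n \<ge> 3"
  shows "\<exists>P\<in>Harm n 6. (\<Sum>i<n. P (pure_power 6 i)) \<noteq> 0"
proof -
  \<comment> \<open>In the Laplacian, x^4 forces 30 + 2 t + 2 t = 0 for the coefficient t of type
    (4,2), and x^2 y^2 forces 12 t + 12 t + 2 w = 0 for the coefficient w of x^2 y^2 z^2. Hence t =
    -15/2 and w = 90.\<close>
  define p :: "nat \<Rightarrow> nat \<Rightarrow> nat \<Rightarrow> real" where
    "p a b c = (if a + b + c \<noteq> 6 \<or> odd a \<or> odd b \<or> odd c then 0
       else if a = 6 \<or> b = 6 \<or> c = 6 then 1 else if a = 4 \<or> b = 4 \<or> c = 4 then - 15 / 2 else 90)" for a b c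
  have "poly3 p \<in> Harm n 6"
  proof (rule poly3_in_Harm[OF assms])
    show "a + b + c = 6" if "p a b c \<noteq> 0" for a b c
      using that by (auto simp: p_def split: if_splits)
    fix a b c :: nat
    show "real ((a + 2) * (a + 1)) * p (a + 2) b c + real ((b + 2) * (b + 1)) * p a (b + 2) c +
      real ((c + 2) * (c + 1)) * p a b (c + 2) = 0"
    proof (cases "a + b + c = 4")
      case True
      hence "a \<in> {0, 1, 2, 3, 4}" "b \<in> {0, 1, 2, 3, 4}" "c = 4 - a - b" by auto
      thus ?thesis using True by (auto simp: p_def)
    qed (auto simp: p_def)
  qed
  moreover have "(\<Sum>i<n. poly3 p (pure_power 6 i)) \<noteq> 0"
    by (subst sum_poly3_pure_power[OF assms]) (simp_all add: p_def)
  ultimately show ?thesis by blast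
qed

lemma linear_form_on_sum_coeffs:
  "linear_form_on S (\<lambda>P. (\<Sum>i\<in>I. P (f i)) / c)"
  by (simp add: linear_form_on_def sum.distrib sum_distrib_left add_divide_distrib)

lemma prod_theta_moment:
  assumes "theta_moment b s 0 z \<noteq> 0"
  shows "(\<Prod>i<n. theta_moment b s (\<alpha> i) z) = theta_moment b s 0 z ^ n * (\<Prod>i<n. theta_ratio b s (\<alpha> i) z)"
proof -
  have "(\<Prod>i<n. theta_moment b s (\<alpha> i) z) = (\<Prod>i<n. theta_moment b s 0 z * theta_ratio b s (\<alpha> i) z)"
    using assms by (intro prod.cong) (auto simp: theta_ratio_def)
  thus ?thesis by (simp add: prod.distrib)
qed

text \<open>The fourth product of moments, over the twisted half-integers, drops out because a monomial of
  degree less than \<open>n\<close> omits some variable.\<close>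

lemma lattice_theta_harmonic:
  assumes n: "n > 0" "4 dvd n" and z: "Im z > 0" and P: "P \<in> Harm n d" and d: "d < n"
    and K: "\<And>V :: nat \<Rightarrow> complex. V 0 = 1 \<Longrightarrow> (\<And>a. odd a \<Longrightarrow> V a = 0) \<Longrightarrow>
      (\<Sum>\<alpha>\<in>{\<alpha>. P \<alpha> \<noteq> 0}. of_real (P \<alpha>) * (\<Prod>i<n. V (\<alpha> i))) = K V * S"
  shows "lattice_theta n (witt_lattice n) (poly_eval n P) z =
    (theta2 z ^ n * K (\<lambda>a. theta_ratio False (1/2) a z) + theta3 z ^ n * K (\<lambda>a. theta_ratio False 0 a z) +
     theta4 z ^ n * K (\<lambda>a. theta_ratio True 0 a z)) * S / 2"
proof -
  let ?A = "{\<alpha>. P \<alpha> \<noteq> 0}"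
  have fin: "finite ?A" using P by (simp add: Harm_def is_rpoly_def)
  note ne = theta2_nonzero[OF z, unfolded theta2_eq] theta3_nonzero[OF z, unfolded theta3_eq]
    theta4_nonzero[OF z, unfolded theta4_eq]
  have twisted: "(\<Prod>i<n. theta_moment True (1/2) (\<alpha> i) z) = 0" if "P \<alpha> \<noteq> 0" for \<alpha>
  proof -
    have sum: "(\<Sum>i<n. \<alpha> i) = d" using P that by (auto simp: Harm_def homogeneous_def)
    have "\<exists>i<n. \<alpha> i = 0"
    proof (rule ccontr)
      assume "\<not> ?thesis"
      hence "(\<Sum>i<n. 1) \<le> (\<Sum>i<n. \<alpha> i)" by (intro sum_mono) (auto simp: Suc_le_eq)
      thus False using sum d by simp
    qed
    then obtain i where "i < n" "\<alpha> i = 0" by blast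
    thus ?thesis by (intro prod_zero) (auto intro!: bexI[of _ i] simp: theta_moment_even_half_twisted)
  qed
  have moments: "(\<Sum>\<alpha>\<in>?A. of_real (P \<alpha>) * (\<Prod>i<n. theta_moment b s (\<alpha> i) z)) =
      theta_moment b s 0 z ^ n * K (\<lambda>a. theta_ratio b s a z) * S"
    if "theta_moment b s 0 z \<noteq> 0" "\<And>a. odd a \<Longrightarrow> theta_moment b s a z = 0" for b s
  proof -
    have "(\<Sum>\<alpha>\<in>?A. of_real (P \<alpha>) * (\<Prod>i<n. theta_moment b s (\<alpha> i) z)) =
        theta_moment b s 0 z ^ n * (\<Sum>\<alpha>\<in>?A. of_real (P \<alpha>) * (\<Prod>i<n. theta_ratio b s (\<alpha> i) z))"
      unfolding prod_theta_moment[OF that(1)] sum_distrib_left by (simp add: mult_ac)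
    also have "(\<Sum>\<alpha>\<in>?A. of_real (P \<alpha>) * (\<Prod>i<n. theta_ratio b s (\<alpha> i) z)) = K (\<lambda>a. theta_ratio b s a z) * S"
      by (rule K) (use that in \<open>auto simp: theta_ratio_def\<close>)
    finally show ?thesis by simp
  qed
  have "lattice_theta n (witt_lattice n) (poly_eval n P) z = (\<Sum>\<alpha>\<in>?A.
     (of_real (P \<alpha>) * (\<Prod>i<n. theta_moment False (1/2) (\<alpha> i) z) + of_real (P \<alpha>) * (\<Prod>i<n. theta_moment False 0 (\<alpha> i) z) +
     of_real (P \<alpha>) * (\<Prod>i<n. theta_moment True 0 (\<alpha> i) z)) / 2)"
    unfolding lattice_theta_poly[OF n z fin]
    by (intro sum.cong refl) (simp add: twisted field_simps)
  also have "\<dots> = (theta2 z ^ n * K (\<lambda>a. theta_ratio False (1/2) a z) * S + theta3 z ^ n * K (\<lambda>a. theta_ratio False 0 a z) * S +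
     theta4 z ^ n * K (\<lambda>a. theta_ratio True 0 a z) * S) / 2"
    unfolding sum_divide_distrib [symmetric] sum.distrib theta2_eq theta3_eq theta4_eq
    by (subst (1 2 3) moments) (use ne theta_moment_odd_int theta_moment_odd_half in auto)
  finally show ?thesis by (simp add: algebra_simps)
qed

theorem lemma10p1:
  fixes n :: nat
  assumes "n \<ge> 8" and "4 dvd n"
  shows "(\<forall>z. Im z > 0 \<longrightarrow>
            lattice_theta n (witt_lattice n) (\<lambda>_. 1) z
              = (theta2 z ^ n + theta3 z ^ n + theta4 z ^ n) / 2)
       \<and> (\<forall>P\<in>Harm n 2. \<forall>z. Im z > 0 \<longrightarrow>
            lattice_theta n (witt_lattice n) (poly_eval n P) z = 0)
       \<and> (\<exists>c1. linear_form_on (Harm n 4) c1 \<and> (\<exists>P\<in>Harm n 4. c1 P \<noteq> 0) \<and>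
            (\<forall>P\<in>Harm n 4. \<forall>z. Im z > 0 \<longrightarrow>
              lattice_theta n (witt_lattice n) (poly_eval n P) z
                = complex_of_real (c1 P) * theta2 z ^ 4 * theta3 z ^ 4 * theta4 z ^ 4 *
                  (- (theta2 z ^ (n - 4)) + theta3 z ^ (n - 4) - theta4 z ^ (n - 4))))
       \<and> (\<exists>c2. linear_form_on (Harm n 6) c2 \<and> (\<exists>P\<in>Harm n 6. c2 P \<noteq> 0) \<and>
            (\<forall>P\<in>Harm n 6. \<forall>z. Im z > 0 \<longrightarrow>
              lattice_theta n (witt_lattice n) (poly_eval n P) z
                = complex_of_real (c2 P) * theta2 z ^ 4 * theta3 z ^ 4 * theta4 z ^ 4 *
                  ((theta3 z ^ 4 + theta4 z ^ 4) * theta2 z ^ (n - 4)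
                   + (theta4 z ^ 4 - theta2 z ^ 4) * theta3 z ^ (n - 4)
                   - (theta2 z ^ 4 + theta3 z ^ 4) * theta4 z ^ (n - 4))))"
proof (intro conjI)
  have n: "n > 0" "4 dvd n" "n \<ge> 3" using assms by auto
  have pow: "x ^ n = x ^ 4 * x ^ (n - 4)" for x :: complex
    using assms(1) by (simp flip: power_add)
  show "\<forall>z. Im z > 0 \<longrightarrow> lattice_theta n (witt_lattice n) (\<lambda>_. 1) z
      = (theta2 z ^ n + theta3 z ^ n + theta4 z ^ n) / 2"
    using lattice_theta_one[OF n(1,2)] by blast
  show "\<forall>P\<in>Harm n 2. \<forall>z. Im z > 0 \<longrightarrow> lattice_theta n (witt_lattice n) (poly_eval n P) z = 0"
  proof (intro ballI allI impI)
    fix P z assume P: "P \<in> Harm n 2" and z: "Im z > 0"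
    show "lattice_theta n (witt_lattice n) (poly_eval n P) z = 0"
      using lattice_theta_harmonic[OF n(1,2) z P, of "\<lambda>_. 0" 0] harmonic_moments_2[OF _ _ P] assms(1) by simp
  qed
  let ?S = "\<lambda>d P. \<Sum>i<n. P (pure_power d i) :: real"
  show "\<exists>c1. linear_form_on (Harm n 4) c1 \<and> (\<exists>P\<in>Harm n 4. c1 P \<noteq> 0) \<and>
      (\<forall>P\<in>Harm n 4. \<forall>z. Im z > 0 \<longrightarrow> lattice_theta n (witt_lattice n) (poly_eval n P) z
        = complex_of_real (c1 P) * theta2 z ^ 4 * theta3 z ^ 4 * theta4 z ^ 4 *
          (- (theta2 z ^ (n - 4)) + theta3 z ^ (n - 4) - theta4 z ^ (n - 4)))"
  \<comment> \<open>16 is the 8 of \<open>theta_ratio_identities\<close> times the 2 from averaging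
    over the sign character.\<close>
  proof (intro exI[of _ "\<lambda>P. ?S 4 P / 16"] conjI ballI allI impI)
    fix P z assume P: "P \<in> Harm n 4" and z: "Im z > 0"
    have "lattice_theta n (witt_lattice n) (poly_eval n P) z =
      (theta2 z ^ n * (- (theta3 z ^ 4 * theta4 z ^ 4) / 8) + theta3 z ^ n * (theta2 z ^ 4 * theta4 z ^ 4 / 8) +
       theta4 z ^ n * (- (theta2 z ^ 4 * theta3 z ^ 4) / 8)) * of_real (?S 4 P) / 2"
      using lattice_theta_harmonic[OF n(1,2) z P, of "\<lambda>V. V 4 - 3 * V 2 ^ 2" "of_real (?S 4 P)"]
        harmonic_moments_4[OF _ _ P] assms(1)
      unfolding theta_ratio_identities[OF z] by simp
    thus "lattice_theta n (witt_lattice n) (poly_eval n P) z =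
        complex_of_real (?S 4 P / 16) * theta2 z ^ 4 * theta3 z ^ 4 * theta4 z ^ 4 *
          (- (theta2 z ^ (n - 4)) + theta3 z ^ (n - 4) - theta4 z ^ (n - 4))"
      unfolding pow by (simp add: algebra_simps)
  qed (use linear_form_on_sum_coeffs Harm_4_witness[OF n(3)] in auto)
  show "\<exists>c2. linear_form_on (Harm n 6) c2 \<and> (\<exists>P\<in>Harm n 6. c2 P \<noteq> 0) \<and>
      (\<forall>P\<in>Harm n 6. \<forall>z. Im z > 0 \<longrightarrow> lattice_theta n (witt_lattice n) (poly_eval n P) z
        = complex_of_real (c2 P) * theta2 z ^ 4 * theta3 z ^ 4 * theta4 z ^ 4 *
          ((theta3 z ^ 4 + theta4 z ^ 4) * theta2 z ^ (n - 4) + (theta4 z ^ 4 - theta2 z ^ 4) * theta3 z ^ (n - 4)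
           - (theta2 z ^ 4 + theta3 z ^ 4) * theta4 z ^ (n - 4)))"
  proof (intro exI[of _ "\<lambda>P. ?S 6 P / 16"] conjI ballI allI impI)
    fix P z assume P: "P \<in> Harm n 6" and z: "Im z > 0"
    have "lattice_theta n (witt_lattice n) (poly_eval n P) z =
      (theta2 z ^ n * (theta3 z ^ 4 * theta4 z ^ 4 * (theta3 z ^ 4 + theta4 z ^ 4) / 8) +
       theta3 z ^ n * (theta2 z ^ 4 * theta4 z ^ 4 * (theta4 z ^ 4 - theta2 z ^ 4) / 8) +
       theta4 z ^ n * (- (theta2 z ^ 4 * theta3 z ^ 4 * (theta2 z ^ 4 + theta3 z ^ 4)) / 8)) * of_real (?S 6 P) / 2"
      using lattice_theta_harmonic[OF n(1,2) z P, of "\<lambda>V. V 6 - 15 * V 2 * V 4 + 30 * V 2 ^ 3" "of_real (?S 6 P)"]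
        harmonic_moments_6[OF _ _ P] assms(1)
      unfolding theta_ratio_identities[OF z] by simp
    \<comment> \<open>Here a, b, c stand for the fourth powers of the three thetas and A, B, C for
      their powers with exponent n - 4.\<close>
    moreover have "(a * A * (b * c * (b + c) / 8) + b * B * (a * c * (c - a) / 8) + c * C * (- (a * b * (a + b)) / 8)) * s / 2 =
        s / 16 * a * b * c * ((b + c) * A + (c - a) * B - (a + b) * C)" for a b c A B C s :: complex
      by (simp add: field_simps)
    ultimately show "lattice_theta n (witt_lattice n) (poly_eval n P) z =
        complex_of_real (?S 6 P / 16) * theta2 z ^ 4 * theta3 z ^ 4 * theta4 z ^ 4 *
          ((theta3 z ^ 4 + theta4 z ^ 4) * theta2 z ^ (n - 4) + (theta4 z ^ 4 - theta2 z ^ 4) * theta3 z ^ (n - 4)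
           - (theta2 z ^ 4 + theta3 z ^ 4) * theta4 z ^ (n - 4))"
      unfolding pow by (simp only: of_real_divide of_real_numeral)
  qed (use linear_form_on_sum_coeffs Harm_6_witness[OF n(3)] in auto)
qed

end
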